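(* Let $p\ge 2$ be an even integer, let $\mathcal D\subset\mathbb R$ be an interval, and let $q_0$ be an interior point of $\mathcal D$ (independent of $g$). Consider the reduced ensemble on $\mathcal D$ with temperature $T_E=\beta^{-1}>0$, semiclassical parameter $g\to0^+$, reduced action $I_E(q)=\beta F_{\mathrm{gen}}(q)$ and measure $\mathcal N(g)\rho(q,g)\,dq$ described in the context, where $q_0$ is the unique stable minimum. With $\delta=q-q_0$ chosen independently of $g$, suppose that near $q_0$ $$I_E(q_0+\delta)=I_0+\frac1g\left[\widehat a_p\delta^p+\widehat a_{p+1}\delta^{p+1}+\mathcal O(\delta^{p+2})\right],\qquad \rho(q_0+\delta,g)=\rho_0+\rho_1\delta+\mathcal O(\delta^2),$$ where $\widehat a_p>0$ and $\rho_0>0$. Here $\widehat a_p,\widehat a_{p+1},\rho_0,\rho_1$ are independent of $g$ and the $\mathcal O$ terms are uniform in $g$. Let $Z_{\mathrm{loc}}$ be the contribution of this saddle to the reduced partition function and let $F_{\mathrm{cl}}=I_0/\beta$. Then, as $g\to0^+$, $$\bar F-F_{\mathrm{cl}}=\frac{T_E}{p}+\mathcal O\!\left(T_E\,g^{2/p}\right),$$ $$Z_{\mathrm{loc}}=e^{-I_0}\,\mathcal N(g)\,\rho_0\,C_p\left(\frac{g}{\widehat a_p}\right)^{1/p}\left[1+\mathcal O(g^{2/p})\right],$$ where $$C_p=\int_{-\infty}^{\infty}e^{-x^p}\,dx=\frac2p\,\Gamma\!\left(\frac1p\right).$$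
   Context: Setting (reduced ensemble). For each small $g>0$ there is a real (measurable) action $I_E(q)=\beta F_{\mathrm{gen}}(q)$ on $\mathcal D$, which may depend on $g$, and a measure $\mathcal N(g)\rho(q,g)\,dq$ on $\mathcal D$. Here $\mathcal N(g)>0$ is independent of $q$ and $\rho\ge0$. The value $I_0=I_E(q_0)$ may depend on $g$ (typically it is of order $1/g$). The partition function is $Z=\int_{\mathcal D}\mathcal N(g)\rho(q,g)e^{-I_E(q)}\,dq$. The normalized average of the generalized free energy is $$\bar F=\frac1Z\int_{\mathcal D}\mathcal N(g)\rho(q,g)F_{\mathrm{gen}}(q)e^{-I_E(q)}\,dq .$$ The local contribution is $Z_{\mathrm{loc}}=\int_{|q-q_0|<r}\mathcal N(g)\rho(q,g)e^{-I_E(q)}\,dq$ for a fixed sufficiently small $r>0$ independent of $g$. Unique dominant minimum: the rest of the domain is exponentially suppressed. That is, for every sufficiently small $r>0$ there is $c>0$ such that, as $g\to0^+$, $$\int_{\mathcal D\setminus(q_0-r,q_0+r)}\rho(q,g)\,\bigl(1+|I_E(q)-I_0|\bigr)\,e^{-(I_E(q)-I_0)}\,dq=\mathcal O(e^{-c/g}).$$ *)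

theory Defs
  imports "HOL-Analysis.Analysis" "HOL-Library.Landau_Symbols"
begin

text \<open>
  The following are taken at a fixed value of the semiclassical parameter: \<open>n\<close> is the normalisation,
  \<open>\<rho>\<close> the density, \<open>F\<close> the generalized free energy and \<open>I\<close> the action on the one-dimensional domain.
  The set \<open>A\<close> is the whole domain for the full partition function and a neighbourhood of the saddle
  for its local contribution.
\<close>

definition partition_function ::
    "real set \<Rightarrow> real \<Rightarrow> (real \<Rightarrow> real) \<Rightarrow> (real \<Rightarrow> real) \<Rightarrow> real" where
  "partition_function A n \<rho> I = (LINT q:A|lebesgue. n * \<rho> q * exp (- I q))"

definition mean_free_energy ::
    "real set \<Rightarrow> real \<Rightarrow> (real \<Rightarrow> real) \<Rightarrow> (real \<Rightarrow> real) \<Rightarrow> (real \<Rightarrow> real) \<Rightarrow> real" where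
  "mean_free_energy A n \<rho> F I =
     1 / partition_function A n \<rho> I * (LINT q:A|lebesgue. n * \<rho> q * F q * exp (- I q))"

definition saddle_const :: "nat \<Rightarrow> real" where
  "saddle_const p = (LINT x|lebesgue. exp (- (x ^ p)))"

text \<open>
  Exponential suppression away from \<open>q\<^sub>0\<close>. Integrability is required separately because the library
  integral of a non-integrable function is \<open>0\<close>, which would satisfy the bound vacuously.
\<close>

definition unique_dominant_minimum ::
    "real set \<Rightarrow> real \<Rightarrow> (real \<Rightarrow> real \<Rightarrow> real) \<Rightarrow> (real \<Rightarrow> real \<Rightarrow> real) \<Rightarrow> bool" where
  "unique_dominant_minimum D q\<^sub>0 \<rho> I \<longleftrightarrow>
     (\<forall>\<^sub>F r in at_right 0. \<exists>c>0.
        (\<forall>\<^sub>F g in at_right 0. set_integrable lebesgue (D - {q\<^sub>0 - r<..<q\<^sub>0 + r})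
           (\<lambda>q. \<rho> g q * (1 + \<bar>I g q - I g q\<^sub>0\<bar>) * exp (- (I g q - I g q\<^sub>0)))) \<and>
        (\<lambda>g. LINT q:D - {q\<^sub>0 - r<..<q\<^sub>0 + r}|lebesgue.
           \<rho> g q * (1 + \<bar>I g q - I g q\<^sub>0\<bar>) * exp (- (I g q - I g q\<^sub>0)))
          \<in> O[at_right 0](\<lambda>g. exp (- c / g)))"

end

theory Submission
  imports Defs
begin

text \<open>
  With \<open>s = (g / a\<^sub>p)\<^bsup>1/p\<^esup>\<close>, \<open>q = q\<^sub>0 + s x\<close> and \<open>J = I\<^sub>E - I\<^sub>0\<close>, the expansions read
  \<open>J = x\<^sup>p + s b x\<^bsup>p+1\<^esup> + O(s\<^sup>2 x\<^bsup>p+2\<^esup>)\<close>, where \<open>b = a\<^sub>p\<^sub>1 / a\<^sub>p\<close>, and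
  \<open>\<rho> = \<rho>\<^sub>0 + \<rho>\<^sub>1 s x + O(s\<^sup>2 x\<^sup>2)\<close>. For \<open>\<psi>\<close> smooth and decaying like \<open>exp (- t / 2)\<close>, the term of
  order \<open>s\<close> in \<open>\<rho> \<psi>(J)\<close> is an odd function of \<open>x\<close>, so it integrates to zero over a symmetric
  neighbourhood of \<open>q\<^sub>0\<close>, and \<open>\<integral> \<rho> \<psi>(J) dq = \<rho>\<^sub>0 s \<integral> \<psi>(x\<^sup>p) dx + O(s\<^sup>3)\<close>. Taking
  \<open>\<psi> t = exp (- t)\<close> gives \<open>Z\<^sub>l\<^sub>o\<^sub>c\<close>; taking \<open>\<psi> t = t exp (- t)\<close> as well, the excess free energy is
  \<open>T\<^sub>E\<close> times the quotient of the two integrals, whose leading coefficients have ratio \<open>1 / p\<close>.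
\<close>

section \<open>Absolute moments of \<open>exp (- (c * x ^ p))\<close> in terms of the Gamma
  function\<close>

text \<open>Euler's integral over \<open>{0..}\<close> loses only the null set \<open>{0}\<close>.
  The open half line is the form needed below, being the exact image of a half line without 0 under
  \<open>x \<mapsto> c * x ^ p\<close>.\<close>

lemma gamma_half_line:
  assumes "\<alpha> > (0::real)"
  shows "(\<lambda>t. t powr (\<alpha> - 1) / exp t) absolutely_integrable_on {0<..}"
    and "integral {0<..} (\<lambda>t. t powr (\<alpha> - 1) / exp t) = Gamma \<alpha>"
proof -
  have "((\<lambda>t. t powr (\<alpha> - 1) / exp t) has_integral Gamma \<alpha>) {0<..}"
    using Gamma_integral_real[OF assms]
    by (subst has_integral_spike_set_eq[where T = "{0..}"])
       (auto intro: negligible_subset[of "{0}"])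
  then show "integral {0<..} (\<lambda>t. t powr (\<alpha> - 1) / exp t) = Gamma \<alpha>"
    and "(\<lambda>t. t powr (\<alpha> - 1) / exp t) absolutely_integrable_on {0<..}"
    by (auto intro!: nonnegative_absolutely_integrable_1)
qed

text \<open>The substitution \<open>t = c * x ^ p\<close> turns Euler's integral for
  \<open>Gamma \<alpha>\<close> into this moment. Since \<open>p\<close> is even, the map is
  injective on each open half line and sends either of them onto \<open>{0<..}\<close>, so both
  signs are treated together.\<close>

lemma power_exp_moment_half_line:
  fixes c :: real and p m :: nat and S :: "real set"
  assumes p: "even p" "p > 0" and c: "c > 0" and S: "S = {0<..} \<or> S = {..<0}"
  defines "\<alpha> \<equiv> real (m + 1) / real p"
  shows "set_integrable lebesgue S (\<lambda>x. \<bar>x\<bar> ^ m * exp (- (c * x ^ p)))"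
    and "(LINT x:S|lebesgue. \<bar>x\<bar> ^ m * exp (- (c * x ^ p))) = Gamma \<alpha> / (p * c powr \<alpha>)"
proof -
  let ?f = "\<lambda>t::real. t powr (\<alpha> - 1) / exp t"
  let ?g = "\<lambda>x::real. c * x ^ p"
  let ?h = "\<lambda>x::real. \<bar>c * (p * x ^ (p - 1))\<bar> * ?f (?g x)"
  have \<alpha>: "\<alpha> > 0" using p by (simp add: \<alpha>_def)
  have S_sets: "S \<in> sets lebesgue" using S by auto
  have ev: "x ^ p = \<bar>x\<bar> ^ p" for x :: real using p by (simp add: power_even_abs)
  have S0: "x \<noteq> 0" if "x \<in> S" for x using S that by auto
  have der: "(?g has_field_derivative c * (p * x ^ (p - 1))) (at x within S)" for x :: real
    by (auto intro!: derivative_eq_intros)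
  have inj: "inj_on ?g S"
  proof (rule inj_onI)
    fix x y assume xy: "x \<in> S" "y \<in> S" "?g x = ?g y"
    then have "\<bar>x\<bar> ^ p = \<bar>y\<bar> ^ p" using c ev by auto
    then have "\<bar>x\<bar> = \<bar>y\<bar>" using p by (simp add: power_eq_iff_eq_base)
    then show "x = y" using xy S by auto
  qed
  have img: "?g ` S = {0<..}"
  proof (intro subset_antisym subsetI)
    fix t :: real assume "t \<in> {0<..}"
    then have t: "t > 0" by simp
    \<comment> \<open>Both \<open>y\<close> and \<open>- y\<close> are preimages of
      \<open>t\<close>, and whichever half line \<open>S\<close> is, it contains one of
      them.\<close>
    define y where "y = root p (t / c)"
    have y: "y > 0" "y ^ p = t / c" using t c p by (auto simp: y_def)
    then have "?g y = t" "?g (- y) = t" using c p by auto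
    moreover have "y \<in> S \<or> - y \<in> S" using S y by auto
    ultimately show "t \<in> ?g ` S" by (metis image_eqI)
  next
    fix t assume "t \<in> ?g ` S"
    then obtain x where "x \<in> S" "t = c * \<bar>x\<bar> ^ p" using ev by auto
    then show "t \<in> {0<..}" using S0 c by simp
  qed
  have h: "?h x = (p * c powr \<alpha>) * (\<bar>x\<bar> ^ m * exp (- (c * x ^ p)))" if "x \<in> S" for x
  proof -
    define y where "y = \<bar>x\<bar>"
    have y: "y > 0" using S0[OF that] by (simp add: y_def)
    have pa: "real p * \<alpha> = m + 1" using p by (simp add: \<alpha>_def)
    have "y ^ (p - 1) * (y ^ p) powr (\<alpha> - 1) = y powr (real (p - 1) + real p * (\<alpha> - 1))"
      unfolding powr_add powr_powr[symmetric] using y by (simp add: powr_realpow)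
    \<comment> \<open>The Jacobian contributes \<open>p - 1\<close> and the Gamma integrand
      \<open>p * (\<alpha> - 1)\<close>; the total \<open>p * \<alpha> - 1\<close> equals
      \<open>m\<close> exactly for \<open>\<alpha> = (m + 1) / p\<close>.\<close>
    also have "real (p - 1) + real p * (\<alpha> - 1) = real m"
      using pa p by (simp add: algebra_simps)
    finally have 1: "y ^ (p - 1) * (y ^ p) powr (\<alpha> - 1) = y ^ m"
      using y by (simp add: powr_realpow)
    have 2: "c * c powr (\<alpha> - 1) = c powr \<alpha>"
      using c by (simp add: powr_diff)
    have "?h x = c * p * y ^ (p - 1) * ((c * y ^ p) powr (\<alpha> - 1) / exp (c * x ^ p))"
      using c by (simp add: abs_mult power_abs ev[of x] y_def)
    also have "\<dots> = p * (c * c powr (\<alpha> - 1)) * (y ^ (p - 1) * (y ^ p) powr (\<alpha> - 1)) * exp (- (c * x ^ p))"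
      using c y by (simp add: powr_mult exp_minus divide_inverse mult_ac)
    finally show ?thesis unfolding 1 2 by (simp add: y_def)
  qed
  have hI: "?h absolutely_integrable_on S \<and> integral S ?h = Gamma \<alpha>"
    using has_absolute_integral_change_of_variables_1'[OF S_sets der inj, of ?f "Gamma \<alpha>"]
      gamma_half_line[OF \<alpha>] unfolding img by blast
  have hA: "?h absolutely_integrable_on S \<longleftrightarrow>
      (\<lambda>x. (p * c powr \<alpha>) * (\<bar>x\<bar> ^ m * exp (- (c * x ^ p)))) absolutely_integrable_on S"
    by (rule set_integrable_cong[OF refl refl h])
  have hB: "integral S ?h = integral S (\<lambda>x. (p * c powr \<alpha>) * (\<bar>x\<bar> ^ m * exp (- (c * x ^ p))))"
    by (rule Henstock_Kurzweil_Integration.integral_cong[OF h])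
  have hC: "(\<lambda>x. (p * c powr \<alpha>) * (\<bar>x\<bar> ^ m * exp (- (c * x ^ p)))) absolutely_integrable_on S"
    using hI hA by blast
  have int: "integral S (\<lambda>x. (p * c powr \<alpha>) * (\<bar>x\<bar> ^ m * exp (- (c * x ^ p)))) = Gamma \<alpha>"
    using conjunct2[OF hI] unfolding hB .
  from hC show *: "set_integrable lebesgue S (\<lambda>x. \<bar>x\<bar> ^ m * exp (- (c * x ^ p)))"
    using p c by simp
  show "(LINT x:S|lebesgue. \<bar>x\<bar> ^ m * exp (- (c * x ^ p))) = Gamma \<alpha> / (p * c powr \<alpha>)"
    unfolding set_lebesgue_integral_eq_integral(2)[OF *]
    using int p c by (simp add: field_simps)
qed

text \<open>The two half lines contribute equally and cover the line up to the null set
  \<open>{0}\<close>. With \<open>\<bar>x\<bar>\<close> in place of \<open>x\<close>, odd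
  \<open>m\<close> also yields integrable dominating functions.\<close>

lemma power_exp_moment:
  fixes c :: real and p m :: nat
  assumes p: "even p" "p > 0" and c: "c > 0"
  defines "\<alpha> \<equiv> real (m + 1) / real p"
  shows "integrable lebesgue (\<lambda>x. \<bar>x\<bar> ^ m * exp (- (c * x ^ p)))"
    and "(LINT x|lebesgue. \<bar>x\<bar> ^ m * exp (- (c * x ^ p))) = 2 * Gamma \<alpha> / (p * c powr \<alpha>)"
proof -
  let ?f = "\<lambda>x::real. \<bar>x\<bar> ^ m * exp (- (c * x ^ p))"
  note P = power_exp_moment_half_line[OF p c, of "{0<..}" m, folded \<alpha>_def]
  note N = power_exp_moment_half_line[OF p c, of "{..<0}" m, folded \<alpha>_def]
  have I: "set_integrable lebesgue ({0<..} \<union> {..<0}) ?f"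
    by (rule set_integrable_Un) (use P N in auto)
  have V: "(LINT x:{0<..} \<union> {..<0}|lebesgue. ?f x) = 2 * Gamma \<alpha> / (p * c powr \<alpha>)"
    by (subst set_integral_Un) (use P N in auto)
  have m: "?f \<in> borel_measurable lebesgue" by (auto intro!: measurable_completion)
  have ae: "AE x in lebesgue. indicator ({0<..} \<union> {..<0}) x *\<^sub>R ?f x = ?f x"
  proof (rule AE_I)
    show "{x \<in> space lebesgue. indicator ({0<..} \<union> {..<0}) x *\<^sub>R ?f x \<noteq> ?f x} \<subseteq> {0}"
      by (auto simp: indicator_def)
  qed auto
  show "integrable lebesgue ?f"
    using I unfolding set_integrable_def
    by (rule integrable_cong_AE_imp[OF _ m]) (use ae in auto)
  show "(LINT x|lebesgue. ?f x) = 2 * Gamma \<alpha> / (p * c powr \<alpha>)"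
    using V unfolding set_lebesgue_integral_def
    by (subst (asm) integral_cong_AE[OF _ m ae])
       (use I in \<open>auto simp: set_integrable_def dest: borel_measurable_integrable\<close>)
qed

section \<open>Pointwise second-order expansion of the rescaled integrand\<close>

text \<open>The Lagrange remainder is evaluated between \<open>u\<close> and \<open>v\<close>, hence
  at or above \<open>lo\<close>. Restricting the bound \<open>B\<close> to that range lets it be
  exponentially small when \<open>lo\<close> is large.\<close>

lemma taylor_quadratic:
  fixes \<psi> :: "real \<Rightarrow> real"
  assumes d1: "\<And>t. (\<psi> has_real_derivative \<psi>' t) (at t)"
    and d2: "\<And>t. (\<psi>' has_real_derivative \<psi>'' t) (at t)"
    and bd: "\<And>t. t \<ge> lo \<Longrightarrow> \<bar>\<psi>'' t\<bar> \<le> B" and "u \<ge> lo" "v \<ge> lo"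
  shows "\<bar>\<psi> v - \<psi> u - \<psi>' u * (v - u)\<bar> \<le> B / 2 * (v - u)\<^sup>2"
proof (cases "v = u")
  case False
  \<comment> \<open>The derivative sequence for \<open>Taylor\<close>; every index from 2 on returns
    \<open>\<psi>''\<close>, and the remainder uses index 2.\<close>
  define diff where "diff = (\<lambda>m::nat. if m = 0 then \<psi> else if m = 1 then \<psi>' else \<psi>'')"
  have "\<exists>t. (if v < u then v < t \<and> t < u else u < t \<and> t < v) \<and>
    \<psi> v = (\<Sum>m<2. (diff m u / fact m) * (v - u)^m) + (diff 2 t / fact 2) * (v - u)^2"
    by (rule Taylor[where a="min u v" and b="max u v"])
       (use False d1 d2 in \<open>auto simp: diff_def less_2_cases_iff\<close>)
  then obtain t where t': "if v < u then v < t \<and> t < u else u < t \<and> t < v"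
    and eq: "\<psi> v = (\<Sum>m<2. (diff m u / fact m) * (v - u)^m) + (diff 2 t / fact 2) * (v - u)^2"
    by blast
  have t: "t \<ge> lo" using t' assms(4,5) by (auto split: if_splits)
  from eq have "\<psi> v - \<psi> u - \<psi>' u * (v - u) = \<psi>'' t / 2 * (v - u)\<^sup>2"
    by (simp add: diff_def numeral_2_eq_2)
  then have "\<bar>\<psi> v - \<psi> u - \<psi>' u * (v - u)\<bar> = \<bar>\<psi>'' t\<bar> / 2 * (v - u)\<^sup>2"
    by (simp only: abs_mult) simp
  also have "\<dots> \<le> B / 2 * (v - u)\<^sup>2"
    using bd[OF t] by (intro mult_right_mono) auto
  finally show ?thesis .
qed simp

text \<open>On the range \<open>s * \<bar>x\<bar> * (\<bar>b\<bar> + K) \<le> 1 / 2\<close> the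
  perturbed action stays above \<open>x ^ p / 2\<close>. As \<open>\<psi>\<close> and its
  derivatives decay like \<open>exp (- t / 2)\<close>, all remainders carry the integrable factor
  \<open>exp (- x ^ p / 4)\<close>, uniformly in \<open>s\<close>.\<close>

lemma laplace_integrand_expansion:
  fixes x s \<rho>\<^sub>0 \<rho>\<^sub>1 b K L J w :: real and p :: nat and \<psi> :: "real \<Rightarrow> real"
  assumes p: "even p"
    and d1: "\<And>t. (\<psi> has_real_derivative \<psi>' t) (at t)"
    and d2: "\<And>t. (\<psi>' has_real_derivative \<psi>'' t) (at t)"
    and b0: "\<And>t. t \<ge> 0 \<Longrightarrow> \<bar>\<psi> t\<bar> \<le> 2 * exp (- t / 2)"
    and b1: "\<And>t. t \<ge> 0 \<Longrightarrow> \<bar>\<psi>' t\<bar> \<le> 2 * exp (- t / 2)"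
    and b2: "\<And>t. t \<ge> 0 \<Longrightarrow> \<bar>\<psi>'' t\<bar> \<le> 2 * exp (- t / 2)"
    and nn: "s > 0" "K \<ge> 0" "L \<ge> 0" "\<rho>\<^sub>0 \<ge> 0"
    and sx: "s * \<bar>x\<bar> \<le> 1" "s * \<bar>x\<bar> * (\<bar>b\<bar> + K) \<le> 1 / 2"
    and J: "\<bar>J - (x ^ p + s * b * x ^ (p + 1))\<bar> \<le> K * s\<^sup>2 * x ^ (p + 2)"
    and w: "\<bar>w - (\<rho>\<^sub>0 + \<rho>\<^sub>1 * (s * x))\<bar> \<le> L * (s * x)\<^sup>2"
  shows "\<bar>w * \<psi> J - \<rho>\<^sub>0 * \<psi> (x ^ p) - s * (\<rho>\<^sub>1 * (x * \<psi> (x ^ p)) + \<rho>\<^sub>0 * b * (x ^ (p + 1) * \<psi>' (x ^ p)))\<bar>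
    \<le> s\<^sup>2 * ((2 * L * \<bar>x\<bar> ^ 2 + 2 * \<bar>\<rho>\<^sub>1 * b\<bar> * \<bar>x\<bar> ^ (p + 2)
         + (\<rho>\<^sub>0 + \<bar>\<rho>\<^sub>1\<bar>) * (2 * K * \<bar>x\<bar> ^ (p + 2) + (\<bar>b\<bar> + K)\<^sup>2 * \<bar>x\<bar> ^ (2 * p + 2)))
       * exp (- (1 / 4 * x ^ p)))"
proof -
  define y where "y = \<bar>x\<bar>"
  define u where "u = x ^ p"
  define E where "E = exp (- u / 4)"
  define B where "B = \<bar>b\<bar> + K"
  have y: "y \<ge> 0" "s * y \<le> 1" using sx by (auto simp: y_def)
  have B: "B \<ge> 0" using nn by (simp add: B_def)
  have u: "u = y ^ p" "u \<ge> 0" using p by (auto simp: u_def y_def power_even_abs)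
  have xp2: "x ^ (p + 2) = y ^ (p + 2)" using p by (simp add: y_def power_even_abs)
  have axp1: "\<bar>x ^ (p + 1)\<bar> = y ^ (p + 1)" by (simp only: y_def power_abs)
  have Ju: "\<bar>J - u - s * b * x ^ (p + 1)\<bar> \<le> K * s\<^sup>2 * y ^ (p + 2)"
    using J[unfolded xp2] by (simp add: u_def diff_diff_eq)
  have "\<bar>J - u\<bar> \<le> \<bar>s * b * x ^ (p + 1)\<bar> + K * s\<^sup>2 * y ^ (p + 2)" using Ju by linarith
  also have "\<bar>s * b * x ^ (p + 1)\<bar> = s * \<bar>b\<bar> * y ^ (p + 1)"
    using nn by (simp only: abs_mult axp1 abs_of_pos)
  \<comment> \<open>A spare factor \<open>s * y \<le> 1\<close> is given up, so that the quadratic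
    error is of the same form as the linear term and the two combine into \<open>B\<close>.\<close>
  also have "K * s\<^sup>2 * y ^ (p + 2) = K * s * y ^ (p + 1) * (s * y)"
    by (simp add: power2_eq_square)
  also have "\<dots> \<le> K * s * y ^ (p + 1) * 1"
    using y nn by (intro mult_left_mono) auto
  finally have dJ: "\<bar>J - u\<bar> \<le> s * B * y ^ (p + 1)" by (simp add: B_def algebra_simps)
  \<comment> \<open>The deviation of \<open>J\<close> from \<open>u\<close> is at most half of
    \<open>u\<close>; this is where the bound \<open>1 / 2\<close> in the hypothesis enters.\<close>
  have "s * B * y ^ (p + 1) = s * y * B * u" by (simp add: u)
  also have "\<dots> \<le> 1 / 2 * u"
    using sx u by (intro mult_right_mono) (auto simp: y_def B_def)
  finally have J2: "J \<ge> u / 2" using dJ by linarith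
  have dJ_sq: "\<bar>J - u\<bar>\<^sup>2 \<le> (s * B * y ^ (p + 1))\<^sup>2" using dJ by (intro power_mono) auto
  have "(y ^ (p + 1))\<^sup>2 = y ^ (2 * p + 2)"
    by (subst power_mult[symmetric]) (rule arg_cong[of _ _ "power y"], simp)
  then have "(s * B * y ^ (p + 1))\<^sup>2 = s\<^sup>2 * B\<^sup>2 * y ^ (2 * p + 2)"
    by (simp only: power_mult_distrib)
  with dJ_sq have dJ2: "(J - u)\<^sup>2 \<le> s\<^sup>2 * B\<^sup>2 * y ^ (2 * p + 2)"
    by (simp only: power2_abs)
  \<comment> \<open>\<open>u / 2\<close> is a common lower bound for \<open>u\<close>,
    \<open>J\<close> and the intermediate point of Taylor's formula, so \<open>E\<close> serves for
    all three.\<close>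
  have E: "2 * exp (- t / 2) \<le> 2 * E" if "t \<ge> u / 2" for t using that by (simp add: E_def)
  have \<psi>J: "\<bar>\<psi> J\<bar> \<le> 2 * E" using b0[of J] E[of J] J2 u by linarith
  have \<psi>'u: "\<bar>\<psi>' u\<bar> \<le> 2 * E" using b1[of u] E[of u] u by linarith
  have "\<bar>\<psi>'' t\<bar> \<le> 2 * E" if "t \<ge> u / 2" for t using b2[of t] E[OF that] that u by linarith
  from taylor_quadratic[of \<psi> \<psi>' \<psi>'' "u / 2" "2 * E" u J, OF d1 d2 this]
  have "\<bar>\<psi> J - \<psi> u - \<psi>' u * (J - u)\<bar> \<le> E * (J - u)\<^sup>2" using J2 u by simp
  also have "\<dots> \<le> E * (s\<^sup>2 * B\<^sup>2 * y ^ (2 * p + 2))"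
    using dJ2 by (intro mult_left_mono) (auto simp: E_def)
  finally have R: "\<bar>\<psi> J - \<psi> u - \<psi>' u * (J - u)\<bar> \<le> E * (s\<^sup>2 * B\<^sup>2 * y ^ (2 * p + 2))" .
  have R': "\<bar>\<psi>' u * (J - u - s * b * x ^ (p + 1))\<bar> \<le> 2 * E * (K * s\<^sup>2 * y ^ (p + 2))"
    unfolding abs_mult using \<psi>'u Ju by (intro mult_mono) (auto simp: E_def)
  \<comment> \<open>The error of \<open>\<psi> J\<close> against its first-order part. It splits
    into the Taylor remainder and \<open>\<psi>' u\<close> times the second-order error of
    \<open>J\<close> itself.\<close>
  define D where "D = \<psi> J - \<psi> u - \<psi>' u * (s * b * x ^ (p + 1))"
  have "D = (\<psi> J - \<psi> u - \<psi>' u * (J - u)) + \<psi>' u * (J - u - s * b * x ^ (p + 1))"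
    by (simp add: D_def algebra_simps)
  then have "\<bar>D\<bar> \<le> E * (s\<^sup>2 * B\<^sup>2 * y ^ (2 * p + 2)) + 2 * E * (K * s\<^sup>2 * y ^ (p + 2))"
    using R R' by linarith
  moreover have "\<bar>\<rho>\<^sub>0 + \<rho>\<^sub>1 * (s * x)\<bar> \<le> \<rho>\<^sub>0 + \<bar>\<rho>\<^sub>1\<bar>"
  proof -
    have "\<bar>\<rho>\<^sub>1 * (s * x)\<bar> = \<bar>\<rho>\<^sub>1\<bar> * (s * y)" using nn by (simp add: abs_mult y_def)
    also have "\<dots> \<le> \<bar>\<rho>\<^sub>1\<bar> * 1" using y by (intro mult_left_mono) auto
    finally show ?thesis using nn by linarith
  qed
  ultimately have T2: "\<bar>(\<rho>\<^sub>0 + \<rho>\<^sub>1 * (s * x)) * D\<bar>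
      \<le> (\<rho>\<^sub>0 + \<bar>\<rho>\<^sub>1\<bar>) * (E * (s\<^sup>2 * B\<^sup>2 * y ^ (2 * p + 2)) + 2 * E * (K * s\<^sup>2 * y ^ (p + 2)))"
    unfolding abs_mult using nn by (intro mult_mono) auto
  have T1: "\<bar>(w - (\<rho>\<^sub>0 + \<rho>\<^sub>1 * (s * x))) * \<psi> J\<bar> \<le> L * (s * x)\<^sup>2 * (2 * E)"
    unfolding abs_mult using w \<psi>J nn by (intro mult_mono) auto
  have "\<bar>\<rho>\<^sub>1 * b * s\<^sup>2 * x ^ (p + 2) * \<psi>' u\<bar> = \<bar>\<rho>\<^sub>1 * b\<bar> * s\<^sup>2 * y ^ (p + 2) * \<bar>\<psi>' u\<bar>"
    using y unfolding xp2 by (simp add: abs_mult)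
  also have "\<dots> \<le> \<bar>\<rho>\<^sub>1 * b\<bar> * s\<^sup>2 * y ^ (p + 2) * (2 * E)"
    using \<psi>'u y by (intro mult_left_mono) auto
  finally have T3: "\<bar>\<rho>\<^sub>1 * b * s\<^sup>2 * x ^ (p + 2) * \<psi>' u\<bar> \<le> \<bar>\<rho>\<^sub>1 * b\<bar> * s\<^sup>2 * y ^ (p + 2) * (2 * E)" .
  \<comment> \<open>Three sources of order \<open>s\<^sup>2\<close>: the remainder of
    \<open>w\<close>, the remainder \<open>D\<close> of \<open>\<psi> J\<close>, and the product of
    the two first-order corrections.\<close>
  have eq: "w * \<psi> J - \<rho>\<^sub>0 * \<psi> u - s * (\<rho>\<^sub>1 * (x * \<psi> u) + \<rho>\<^sub>0 * b * (x ^ (p + 1) * \<psi>' u))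
    = (w - (\<rho>\<^sub>0 + \<rho>\<^sub>1 * (s * x))) * \<psi> J + (\<rho>\<^sub>0 + \<rho>\<^sub>1 * (s * x)) * D
      + \<rho>\<^sub>1 * b * s\<^sup>2 * x ^ (p + 2) * \<psi>' u"
    by (simp add: D_def algebra_simps power2_eq_square)
  have "\<bar>w * \<psi> J - \<rho>\<^sub>0 * \<psi> u - s * (\<rho>\<^sub>1 * (x * \<psi> u) + \<rho>\<^sub>0 * b * (x ^ (p + 1) * \<psi>' u))\<bar>
    \<le> L * (s * x)\<^sup>2 * (2 * E)
      + (\<rho>\<^sub>0 + \<bar>\<rho>\<^sub>1\<bar>) * (E * (s\<^sup>2 * B\<^sup>2 * y ^ (2 * p + 2)) + 2 * E * (K * s\<^sup>2 * y ^ (p + 2)))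
      + \<bar>\<rho>\<^sub>1 * b\<bar> * s\<^sup>2 * y ^ (p + 2) * (2 * E)"
    unfolding eq using T1 T2 T3 by linarith
  also have "\<dots> = s\<^sup>2 * ((2 * L * y ^ 2 + 2 * \<bar>\<rho>\<^sub>1 * b\<bar> * y ^ (p + 2)
         + (\<rho>\<^sub>0 + \<bar>\<rho>\<^sub>1\<bar>) * (2 * K * y ^ (p + 2) + B\<^sup>2 * y ^ (2 * p + 2))) * E)"
    by (simp add: algebra_simps power_mult_distrib y_def)
  finally show ?thesis by (simp add: y_def u_def E_def B_def)
qed

section \<open>Integrating the expansion over a symmetric neighbourhood\<close>

lemma lebesgue_integrable_shift_scale:
  fixes h :: "real \<Rightarrow> real"
  assumes "s > 0" "integrable lebesgue h"
  shows "integrable lebesgue (\<lambda>q. h ((q - q\<^sub>0) / s))"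
  using lebesgue_integrable_real_affine[OF assms(2), of "1 / s" "- q\<^sub>0 / s"] assms(1)
  by (simp add: diff_divide_distrib)

lemma lebesgue_integral_shift_scale:
  fixes h :: "real \<Rightarrow> real"
  assumes "s > 0"
  shows "(LINT q|lebesgue. h ((q - q\<^sub>0) / s)) = s * (LINT x|lebesgue. h x)"
  using lebesgue_integral_real_affine[of "1 / s" h "- q\<^sub>0 / s"] assms
  by (simp add: diff_divide_distrib)

text \<open>The pointwise remainder integrates to \<open>s * s\<^sup>2\<close>, the extra
  \<open>s\<close> coming from \<open>dq = s dx\<close>, and the odd term cancels by reflection. The
  constant \<open>C\<close> is fixed before \<open>s\<close>, \<open>J\<close> and \<open>w\<close>,
  so one constant serves all values of \<open>g\<close>.\<close>

lemma laplace_local: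
  fixes r \<rho>\<^sub>0 \<rho>\<^sub>1 b K L q\<^sub>0 :: real and p :: nat and \<psi> :: "real \<Rightarrow> real"
  assumes p: "even p" "p > 0"
    and d1: "\<And>t. (\<psi> has_real_derivative \<psi>' t) (at t)"
    and d2: "\<And>t. (\<psi>' has_real_derivative \<psi>'' t) (at t)"
    and b0: "\<And>t. t \<ge> 0 \<Longrightarrow> \<bar>\<psi> t\<bar> \<le> 2 * exp (- t / 2)"
    and b1: "\<And>t. t \<ge> 0 \<Longrightarrow> \<bar>\<psi>' t\<bar> \<le> 2 * exp (- t / 2)"
    and b2: "\<And>t. t \<ge> 0 \<Longrightarrow> \<bar>\<psi>'' t\<bar> \<le> 2 * exp (- t / 2)"
    and nn: "K \<ge> 0" "L \<ge> 0" "\<rho>\<^sub>0 \<ge> 0"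
    and r: "r > 0" "r \<le> 1" "r * (\<bar>b\<bar> + K) \<le> 1 / 2"
  defines "S \<equiv> {q\<^sub>0 - r<..<q\<^sub>0 + r}"
  obtains C where "\<And>s J w. s > 0 \<Longrightarrow>
      set_borel_measurable lebesgue S J \<Longrightarrow> set_borel_measurable lebesgue S w \<Longrightarrow>
      (\<And>q x. q \<in> S \<Longrightarrow> x = (q - q\<^sub>0) / s \<Longrightarrow>
        \<bar>J q - (x ^ p + s * b * x ^ (p + 1))\<bar> \<le> K * s\<^sup>2 * x ^ (p + 2)) \<Longrightarrow>
      (\<And>q. q \<in> S \<Longrightarrow> \<bar>w q - (\<rho>\<^sub>0 + \<rho>\<^sub>1 * (q - q\<^sub>0))\<bar> \<le> L * (q - q\<^sub>0)\<^sup>2) \<Longrightarrow>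
      set_integrable lebesgue S (\<lambda>q. w q * \<psi> (J q)) \<and>
      \<bar>(LINT q:S|lebesgue. w q * \<psi> (J q)) - \<rho>\<^sub>0 * s * (LINT x|lebesgue. \<psi> (x ^ p))\<bar> \<le> C * s ^ 3"
proof -
  define M :: "nat \<Rightarrow> real \<Rightarrow> real" where "M = (\<lambda>m x. \<bar>x\<bar> ^ m * exp (- (1 / 4 * x ^ p)))"
  have M: "integrable lebesgue (M m)" for m
    unfolding M_def by (rule power_exp_moment) (use p in auto)
  define P where "P = (\<lambda>x::real. (2 * L * \<bar>x\<bar> ^ 2 + 2 * \<bar>\<rho>\<^sub>1 * b\<bar> * \<bar>x\<bar> ^ (p + 2)
         + (\<rho>\<^sub>0 + \<bar>\<rho>\<^sub>1\<bar>) * (2 * K * \<bar>x\<bar> ^ (p + 2) + (\<bar>b\<bar> + K)\<^sup>2 * \<bar>x\<bar> ^ (2 * p + 2)))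
       * exp (- (1 / 4 * x ^ p)))"
  \<comment> \<open>\<open>P\<close> bounds the remainder inside \<open>S\<close>; the second
    summand pays for the main term outside \<open>S\<close>, where there is nothing to compare it
    with.\<close>
  define H where "H = (\<lambda>x. P x + \<rho>\<^sub>0 * (2 / r\<^sup>2) * M 2 x)"
  have "P = (\<lambda>x. 2 * L * M 2 x + 2 * \<bar>\<rho>\<^sub>1 * b\<bar> * M (p + 2) x
         + (\<rho>\<^sub>0 + \<bar>\<rho>\<^sub>1\<bar>) * (2 * K * M (p + 2) x + (\<bar>b\<bar> + K)\<^sup>2 * M (2 * p + 2) x))"
    by (simp add: P_def M_def algebra_simps)
  then have "integrable lebesgue P"
    by (simp only:) (intro Bochner_Integration.integrable_add integrable_mult_right M)
  then have H: "integrable lebesgue H"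
    unfolding H_def by (intro Bochner_Integration.integrable_add integrable_mult_right M)
  have P0: "P x \<ge> 0" for x using nn by (auto simp: P_def)
  have M0: "M m x \<ge> 0" for m x by (simp add: M_def)
  have xp: "x ^ p \<ge> 0" for x :: real using p by (simp add: zero_le_even_power)
  have e: "exp (- (x ^ p) / 2) \<le> exp (- (1 / 4 * x ^ p))" for x :: real using xp[of x] by simp
  have \<psi>M: "\<bar>\<psi> (x ^ p)\<bar> \<le> 2 * exp (- (1 / 4 * x ^ p))" for x using b0[OF xp, of x] e[of x] by linarith
  have \<psi>'M: "\<bar>\<psi>' (x ^ p)\<bar> \<le> 2 * exp (- (1 / 4 * x ^ p))" for x using b1[OF xp, of x] e[of x] by linarith
  have [measurable]: "\<psi> \<in> borel_measurable borel" "\<psi>' \<in> borel_measurable borel"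
    using d1 d2 by (auto intro!: borel_measurable_continuous_onI continuous_at_imp_continuous_on intro: DERIV_isCont)
  \<comment> \<open>The coefficient of \<open>s\<close> in the expansion. It is odd because
    \<open>p\<close> is even.\<close>
  define od where "od = (\<lambda>x. \<rho>\<^sub>1 * (x * \<psi> (x ^ p)) + \<rho>\<^sub>0 * b * (x ^ (p + 1) * \<psi>' (x ^ p)))"
  have \<psi>m: "(\<lambda>x. \<psi> (x ^ p)) \<in> borel_measurable lebesgue"
    and \<psi>xm: "(\<lambda>x. x * \<psi> (x ^ p)) \<in> borel_measurable lebesgue"
    and \<psi>'m: "(\<lambda>x. x ^ (p + 1) * \<psi>' (x ^ p)) \<in> borel_measurable lebesgue"
    by (rule measurable_completion, measurable)+
  have \<psi>int: "integrable lebesgue (\<lambda>x. \<psi> (x ^ p))"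
  proof (rule Bochner_Integration.integrable_bound[OF integrable_mult_right[OF M[of 0], of 2] \<psi>m], rule AE_I2)
    show "norm (\<psi> (x ^ p)) \<le> norm (2 * M 0 x)" for x
      using \<psi>M[of x] by (simp add: M_def)
  qed
  have "integrable lebesgue (\<lambda>x. x * \<psi> (x ^ p))"
  proof (rule Bochner_Integration.integrable_bound[OF integrable_mult_right[OF M[of 1], of 2] \<psi>xm], rule AE_I2)
    show "norm (x * \<psi> (x ^ p)) \<le> norm (2 * M 1 x)" for x
      using mult_left_mono[OF \<psi>M[of x], of "\<bar>x\<bar>"] by (simp add: M_def abs_mult)
  qed
  moreover have "integrable lebesgue (\<lambda>x. x ^ (p + 1) * \<psi>' (x ^ p))"
  proof (rule Bochner_Integration.integrable_bound[OF integrable_mult_right[OF M[of "p + 1"], of 2] \<psi>'m], rule AE_I2)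
    show "norm (x ^ (p + 1) * \<psi>' (x ^ p)) \<le> norm (2 * M (p + 1) x)" for x
      using mult_left_mono[OF \<psi>'M[of x], of "\<bar>x\<bar> ^ (p + 1)"]
      by (simp add: M_def abs_mult power_abs mult_ac)
  qed
  ultimately have odint: "integrable lebesgue od"
    unfolding od_def by (intro Bochner_Integration.integrable_add integrable_mult_right)
  have od_odd: "od (- x) = - od x" for x using p by (simp add: od_def)
  show thesis
  proof (rule that[of "integral\<^sup>L lebesgue H"])
    fix s J w
    assume s: "s > 0"
      and Jm: "set_borel_measurable lebesgue S J" and wm: "set_borel_measurable lebesgue S w"
      and J: "\<And>q x. q \<in> S \<Longrightarrow> x = (q - q\<^sub>0) / s \<Longrightarrow>
        \<bar>J q - (x ^ p + s * b * x ^ (p + 1))\<bar> \<le> K * s\<^sup>2 * x ^ (p + 2)"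
      and w: "\<And>q. q \<in> S \<Longrightarrow> \<bar>w q - (\<rho>\<^sub>0 + \<rho>\<^sub>1 * (q - q\<^sub>0))\<bar> \<le> L * (q - q\<^sub>0)\<^sup>2"
    define X where "X = (\<lambda>q. (q - q\<^sub>0) / s)"
    have sX: "s * X q = q - q\<^sub>0" for q using s by (simp add: X_def)
    have sXa: "s * \<bar>X q\<bar> = \<bar>q - q\<^sub>0\<bar>" for q using s by (simp add: X_def)
    have [measurable]: "S \<in> sets lebesgue" by (simp add: S_def)
    \<comment> \<open>\<open>f\<close> and the odd term \<open>o'\<close> are cut off to
      \<open>S\<close>, while the main term \<open>m\<close> lives on the whole line, so that its
      integral is exactly the wanted constant.\<close>
    define f where "f = (\<lambda>q. indicator S q * (w q * \<psi> (J q)))"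
    define m where "m = (\<lambda>q. \<rho>\<^sub>0 * \<psi> (X q ^ p))"
    define o' where "o' = (\<lambda>q. indicator S q * (s * od (X q)))"
    have bound: "\<bar>f q - m q - o' q\<bar> \<le> s\<^sup>2 * H (X q)" for q
    proof (cases "q \<in> S")
      case True
      have rX: "s * \<bar>X q\<bar> \<le> r" using True by (auto simp: sXa S_def)
      have "s * \<bar>X q\<bar> * (\<bar>b\<bar> + K) \<le> r * (\<bar>b\<bar> + K)"
        using rX nn by (intro mult_right_mono) auto
      then have small: "s * \<bar>X q\<bar> * (\<bar>b\<bar> + K) \<le> 1 / 2" using r by linarith
      have sx1: "s * \<bar>X q\<bar> \<le> 1" using rX r by linarith
      have Jq: "\<bar>J q - (X q ^ p + s * b * X q ^ (p + 1))\<bar> \<le> K * s\<^sup>2 * X q ^ (p + 2)"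
        by (rule J[OF True]) (simp add: X_def)
      have wq: "\<bar>w q - (\<rho>\<^sub>0 + \<rho>\<^sub>1 * (s * X q))\<bar> \<le> L * (s * X q)\<^sup>2"
        using w[OF True] by (simp only: sX)
      have "\<bar>f q - m q - o' q\<bar> \<le> s\<^sup>2 * P (X q)"
        using laplace_integrand_expansion[OF p(1) d1 d2 b0 b1 b2 s nn sx1 small Jq wq] True
        by (simp add: f_def m_def o'_def od_def P_def)
      also have "\<dots> \<le> s\<^sup>2 * H (X q)"
        using nn M0 by (intro mult_left_mono) (auto simp: H_def)
      finally show ?thesis .
    next
      case False
      \<comment> \<open>Outside \<open>S\<close> only \<open>m\<close> survives. Multiplying by
        \<open>(s * X q / r)\<^sup>2 \<ge> 1\<close> turns it into a term of order
        \<open>s\<^sup>2\<close> with one more second moment.\<close>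
      have "s * \<bar>X q\<bar> \<ge> r" using False by (auto simp: sXa S_def)
      then have "(s * \<bar>X q\<bar>)\<^sup>2 \<ge> r\<^sup>2" using r by (intro power_mono) auto
      then have 1: "1 \<le> s\<^sup>2 * (X q)\<^sup>2 / r\<^sup>2" using r by (simp add: power_mult_distrib)
      have "\<bar>f q - m q - o' q\<bar> = \<rho>\<^sub>0 * \<bar>\<psi> (X q ^ p)\<bar>"
        using False nn by (simp add: f_def m_def o'_def abs_mult)
      also have "\<dots> \<le> \<rho>\<^sub>0 * (2 * exp (- (1 / 4 * X q ^ p)))"
        using \<psi>M nn by (intro mult_left_mono) auto
      also have "\<dots> \<le> \<rho>\<^sub>0 * (2 * exp (- (1 / 4 * X q ^ p))) * (s\<^sup>2 * (X q)\<^sup>2 / r\<^sup>2)"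
        using mult_left_mono[OF 1, of "\<rho>\<^sub>0 * (2 * exp (- (1 / 4 * X q ^ p)))"] nn by simp
      also have "\<dots> = s\<^sup>2 * (\<rho>\<^sub>0 * (2 / r\<^sup>2) * M 2 (X q))" by (simp add: M_def)
      also have "\<dots> \<le> s\<^sup>2 * H (X q)"
        using P0 by (intro mult_left_mono) (auto simp: H_def)
      finally show ?thesis .
    qed
    \<comment> \<open>Measurability of \<open>J\<close> and \<open>w\<close> is given on
      \<open>S\<close> only, so both are cut off; the value \<open>\<psi> 0\<close> arising outside
      \<open>S\<close> is multiplied by 0.\<close>
    have "f = (\<lambda>q. (indicator S q *\<^sub>R w q) * \<psi> (indicator S q *\<^sub>R J q))"
      by (auto simp: f_def indicator_def fun_eq_iff)
    moreover have "\<dots> \<in> borel_measurable lebesgue"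
      using Jm wm unfolding set_borel_measurable_def by measurable
    ultimately have fm: "f \<in> borel_measurable lebesgue" by simp
    have HX: "integrable lebesgue (\<lambda>q. s\<^sup>2 * H (X q))"
      unfolding X_def by (intro integrable_mult_right lebesgue_integrable_shift_scale[OF s H])
    have mi: "integrable lebesgue m"
      unfolding m_def X_def by (intro integrable_mult_right lebesgue_integrable_shift_scale[OF s \<psi>int])
    have oi: "integrable lebesgue o'"
      unfolding o'_def X_def
      using integrable_mult_indicator[OF \<open>S \<in> sets lebesgue\<close>
          integrable_mult_right[OF lebesgue_integrable_shift_scale[OF s odint]], of s q\<^sub>0] by simp
    have di: "integrable lebesgue (\<lambda>q. f q - m q - o' q)"
      by (rule Bochner_Integration.integrable_bound[OF HX])
         (use fm mi oi bound in \<open>auto intro!: AE_I2 order_trans[OF bound]\<close>)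
    have "integrable lebesgue (\<lambda>q. (f q - m q - o' q) + (m q + o' q))"
      by (intro Bochner_Integration.integrable_add di mi oi)
    then have fi: "integrable lebesgue f" by simp
    \<comment> \<open>Reflection about \<open>q\<^sub>0\<close> preserves \<open>S\<close> and
      changes the sign of \<open>o'\<close>, so its integral vanishes.\<close>
    have "o' (2 * q\<^sub>0 + (- 1) * q) = - o' q" for q
    proof -
      have "X (2 * q\<^sub>0 + (- 1) * q) = - X q" by (simp add: X_def minus_divide_left)
      moreover have "2 * q\<^sub>0 + (- 1) * q \<in> S \<longleftrightarrow> q \<in> S" by (auto simp: S_def)
      ultimately show ?thesis by (simp add: o'_def od_odd indicator_def)
    qed
    then have o0: "integral\<^sup>L lebesgue o' = 0"
      using lebesgue_integral_real_affine[of "- 1" o' "2 * q\<^sub>0"] by simp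
    have mI: "integral\<^sup>L lebesgue m = \<rho>\<^sub>0 * s * (LINT x|lebesgue. \<psi> (x ^ p))"
      using lebesgue_integral_shift_scale[OF s, of "\<lambda>x. \<psi> (x ^ p)" q\<^sub>0] by (simp add: m_def X_def)
    have "\<bar>LINT q|lebesgue. f q - m q - o' q\<bar> \<le> (LINT q|lebesgue. \<bar>f q - m q - o' q\<bar>)"
      using integral_norm_bound[of lebesgue "\<lambda>q. f q - m q - o' q"] by simp
    also have "\<dots> \<le> (LINT q|lebesgue. s\<^sup>2 * H (X q))"
      using di by (intro integral_mono HX bound integrable_abs) auto
    also have "\<dots> = integral\<^sup>L lebesgue H * s ^ 3"
      using lebesgue_integral_shift_scale[OF s, of H q\<^sub>0]
      by (simp add: X_def power2_eq_square power3_eq_cube)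
    also have "(LINT q|lebesgue. f q - m q - o' q) = integral\<^sup>L lebesgue f - \<rho>\<^sub>0 * s * (LINT x|lebesgue. \<psi> (x ^ p))"
      using fi mi oi o0 mI by simp
    finally show "set_integrable lebesgue S (\<lambda>q. w q * \<psi> (J q)) \<and>
      \<bar>(LINT q:S|lebesgue. w q * \<psi> (J q)) - \<rho>\<^sub>0 * s * (LINT x|lebesgue. \<psi> (x ^ p))\<bar>
        \<le> integral\<^sup>L lebesgue H * s ^ 3"
      using fi by (simp add: set_integrable_def set_lebesgue_integral_def f_def)
  qed
qed

section \<open>The saddle constant and the first moment of the action\<close>

lemma saddle_const_eq:
  assumes "even p" "p > 0"
  shows "saddle_const p = 2 / real p * Gamma (1 / real p)"
  using power_exp_moment(2)[OF assms, of 1 0] by (simp add: saddle_const_def)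

lemma saddle_const_pos:
  assumes "even p" "p > 0"
  shows "saddle_const p > 0"
  using assms by (auto simp: saddle_const_eq intro!: mult_pos_pos)

text \<open>\<open>Gamma (1 / p + 1) = Gamma (1 / p) / p\<close>. This quotient of moments is the
  source of the coefficient \<open>1 / p\<close> in the excess free energy.\<close>

lemma first_moment_eq_saddle_const:
  assumes "even p" "p > 0"
  shows "(LINT x|lebesgue. x ^ p * exp (- (x ^ p))) = saddle_const p / real p"
proof -
  have "Gamma (1 / real p + 1) = 1 / real p * Gamma (1 / real p)"
    using assms by (intro Gamma_plus1) (auto simp: divide_le_0_iff)
  then show ?thesis
    using power_exp_moment(2)[OF assms, of 1 p] assms
    by (simp add: saddle_const_eq power_even_abs add_divide_distrib add.commute)
qed

section \<open>From the expansions at the saddle to the local integrals\<close>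

text \<open>An event of the product filter contains a rectangle, so the radius \<open>d\<close> and
  the constant \<open>C\<close> do not depend on \<open>g\<close>: this is the uniformity in
  \<open>g\<close> of the error terms. The displacement 0 is included.\<close>

lemma bigo_at_right_prod_nhds0E:
  fixes f h :: "real \<Rightarrow> real \<Rightarrow> real"
  assumes "(\<lambda>(g, \<delta>). f g \<delta>) \<in> O[at_right 0 \<times>\<^sub>F nhds 0](\<lambda>(g, \<delta>). h g \<delta>)"
  obtains C d where "C > 0" "d > 0"
    "\<forall>\<^sub>F g in at_right 0. \<forall>\<delta>. \<bar>\<delta>\<bar> < d \<longrightarrow> \<bar>f g \<delta>\<bar> \<le> C * \<bar>h g \<delta>\<bar>"
proof -
  from assms obtain C where C: "C > 0"
    "\<forall>\<^sub>F x in at_right 0 \<times>\<^sub>F nhds 0. norm (case x of (g, \<delta>) \<Rightarrow> f g \<delta>) \<le> C * norm (case x of (g, \<delta>) \<Rightarrow> h g \<delta>)"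
    by (rule landau_o.bigE)
  then obtain P Q where PQ: "eventually P (at_right 0)" "eventually Q (nhds 0)"
    "\<And>g \<delta>. P g \<Longrightarrow> Q \<delta> \<Longrightarrow> \<bar>f g \<delta>\<bar> \<le> C * \<bar>h g \<delta>\<bar>"
    unfolding eventually_prod_filter by auto
  from PQ(2) obtain d where "d > 0" "\<And>\<delta>. \<bar>\<delta>\<bar> < d \<Longrightarrow> Q \<delta>"
    unfolding eventually_nhds_metric by (auto simp: dist_real_def)
  with C(1) PQ show thesis
    by (intro that[of C d]) (auto elim: eventually_mono)
qed

text \<open>With \<open>s = (g / a) powr (1 / p)\<close> and \<open>\<delta> = s * x\<close>, the
  relation \<open>g = a * s ^ p\<close> removes \<open>1 / g\<close> from the expansion of the
  action and leaves \<open>b = a' / a\<close> and error constant \<open>K / a\<close>. Then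
  \<open>laplace_local\<close> applies to \<open>\<psi> t = exp (- t)\<close> and
  \<open>\<psi> t = t * exp (- t)\<close>. The constant \<open>C\<close> may depend on
  \<open>r\<close>.\<close>

lemma saddle_local:
  fixes p :: nat and D :: "real set" and q\<^sub>0 a a' \<rho>\<^sub>0 \<rho>\<^sub>1 :: real and I \<rho> :: "real \<Rightarrow> real \<Rightarrow> real"
  assumes p: "even p" "p > 0" and q0: "q\<^sub>0 \<in> interior D"
    and \<rho>m: "\<forall>\<^sub>F g in at_right 0. set_borel_measurable lebesgue D (\<rho> g)"
    and Im: "\<forall>\<^sub>F g in at_right 0. set_borel_measurable lebesgue D (I g)"
    and Iexp: "(\<lambda>(g, \<delta>). I g (q\<^sub>0 + \<delta>) - (I g q\<^sub>0 + 1 / g * (a * \<delta> ^ p + a' * \<delta> ^ (p + 1))))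
           \<in> O[at_right 0 \<times>\<^sub>F nhds 0](\<lambda>(g, \<delta>). 1 / g * \<delta> ^ (p + 2))"
    and \<rho>exp: "(\<lambda>(g, \<delta>). \<rho> g (q\<^sub>0 + \<delta>) - (\<rho>\<^sub>0 + \<rho>\<^sub>1 * \<delta>)) \<in> O[at_right 0 \<times>\<^sub>F nhds 0](\<lambda>(g, \<delta>). \<delta> ^ 2)"
    and a: "a > 0" and \<rho>0: "\<rho>\<^sub>0 > 0"
  shows "\<forall>\<^sub>F r in at_right 0. {q\<^sub>0 - r<..<q\<^sub>0 + r} \<subseteq> D \<and> (\<exists>C. \<forall>\<^sub>F g in at_right 0.
      set_integrable lebesgue {q\<^sub>0 - r<..<q\<^sub>0 + r} (\<lambda>q. \<rho> g q * exp (- (I g q - I g q\<^sub>0))) \<and>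
      set_integrable lebesgue {q\<^sub>0 - r<..<q\<^sub>0 + r} (\<lambda>q. \<rho> g q * ((I g q - I g q\<^sub>0) * exp (- (I g q - I g q\<^sub>0)))) \<and>
      \<bar>(LINT q:{q\<^sub>0 - r<..<q\<^sub>0 + r}|lebesgue. \<rho> g q * exp (- (I g q - I g q\<^sub>0)))
        - \<rho>\<^sub>0 * (g / a) powr (1 / p) * saddle_const p\<bar> \<le> C * ((g / a) powr (1 / p)) ^ 3 \<and>
      \<bar>(LINT q:{q\<^sub>0 - r<..<q\<^sub>0 + r}|lebesgue. \<rho> g q * ((I g q - I g q\<^sub>0) * exp (- (I g q - I g q\<^sub>0))))
        - \<rho>\<^sub>0 * (g / a) powr (1 / p) * (saddle_const p / p)\<bar> \<le> C * ((g / a) powr (1 / p)) ^ 3)"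
proof -
  from Iexp obtain K d1 where K: "K > 0" and d1: "d1 > 0" and
    EK: "\<forall>\<^sub>F g in at_right 0. \<forall>\<delta>. \<bar>\<delta>\<bar> < d1 \<longrightarrow>
      \<bar>I g (q\<^sub>0 + \<delta>) - (I g q\<^sub>0 + 1 / g * (a * \<delta> ^ p + a' * \<delta> ^ (p + 1)))\<bar> \<le> K * \<bar>1 / g * \<delta> ^ (p + 2)\<bar>"
    by (rule bigo_at_right_prod_nhds0E)
  from \<rho>exp obtain L d2 where L: "L > 0" and d2: "d2 > 0" and
    EL: "\<forall>\<^sub>F g in at_right 0. \<forall>\<delta>. \<bar>\<delta>\<bar> < d2 \<longrightarrow> \<bar>\<rho> g (q\<^sub>0 + \<delta>) - (\<rho>\<^sub>0 + \<rho>\<^sub>1 * \<delta>)\<bar> \<le> L * \<bar>\<delta> ^ 2\<bar>"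
    by (rule bigo_at_right_prod_nhds0E)
  from q0 obtain d3 where d3: "d3 > 0" "ball q\<^sub>0 d3 \<subseteq> D" by (auto simp: mem_interior)
  define b where "b = a' / a"
  define B where "B = \<bar>b\<bar> + K / a"
  have B: "B > 0" using K a by (simp add: B_def add_nonneg_pos)
  have below: "\<forall>\<^sub>F r in at_right 0. r < e" if "e > 0" for e :: real
    using that unfolding eventually_at_right_field by blast
  \<comment> \<open>Below \<open>d1\<close> and \<open>d2\<close> the expansions hold, below
    \<open>d3\<close> the neighbourhood lies in \<open>D\<close>; the bounds 1 and
    \<open>1 / (2 * B)\<close> are the smallness conditions of \<open>laplace_local\<close>.\<close>
  have r_ev: "\<forall>\<^sub>F r in at_right 0. 0 < r \<and> r < d1 \<and> r < d2 \<and> r < d3 \<and> r < 1 \<and> r < 1 / (2 * B)"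
    using d1 d2 d3 B by (intro eventually_conj eventually_at_right_less below) auto
  show ?thesis
  proof (rule eventually_mono[OF r_ev], elim conjE)
    fix r assume r: "0 < r" "r < d1" "r < d2" "r < d3" "r < 1" "r < 1 / (2 * B)"
    define S where "S = {q\<^sub>0 - r<..<q\<^sub>0 + r}"
    have SD: "S \<subseteq> D" using d3 r by (auto simp: S_def dist_real_def subset_iff)
    have S_sets: "S \<in> sets lebesgue" by (simp add: S_def)
    have "r * (2 * B) < 1" using r(6) B by (simp add: pos_less_divide_eq)
    then have "r * B \<le> 1 / 2" by simp
    then have rB: "r * (\<bar>b\<bar> + K / a) \<le> 1 / 2" by (simp only: B_def)
    have nn: "0 \<le> K / a" "0 \<le> L" "0 \<le> \<rho>\<^sub>0" "0 < r" "r \<le> 1" using K a L \<rho>0 r by auto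
    \<comment> \<open>For \<open>t \<ge> 0\<close> the value
      \<open>2 * exp (t / 2) \<ge> 2 + t\<close> dominates 1, \<open>t\<close>,
      \<open>\<bar>1 - t\<bar>\<close> and \<open>\<bar>t - 2\<bar>\<close>, the polynomial factors
      in both choices of \<open>\<psi>\<close> and their derivatives.\<close>
    have half: "1 + t / 2 \<le> exp (t / 2)" for t :: real by (rule exp_ge_add_one_self)
    have ge: "y \<le> 2 * exp (t / 2) \<Longrightarrow> y * exp (- t) \<le> 2 * exp (- t / 2)" for y t :: real
    proof -
      assume "y \<le> 2 * exp (t / 2)"
      then have "y * exp (- t) \<le> 2 * exp (t / 2) * exp (- t)" by (intro mult_right_mono) auto
      also have "\<dots> = 2 * exp (- t / 2)" by (simp flip: exp_add)
      finally show ?thesis .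
    qed
    \<comment> \<open>Zeroth moment: the weight of the partition function.\<close>
    obtain C0 where C0: "\<And>s J w. s > 0 \<Longrightarrow>
      set_borel_measurable lebesgue S J \<Longrightarrow> set_borel_measurable lebesgue S w \<Longrightarrow>
      (\<And>q x. q \<in> S \<Longrightarrow> x = (q - q\<^sub>0) / s \<Longrightarrow>
        \<bar>J q - (x ^ p + s * b * x ^ (p + 1))\<bar> \<le> K / a * s\<^sup>2 * x ^ (p + 2)) \<Longrightarrow>
      (\<And>q. q \<in> S \<Longrightarrow> \<bar>w q - (\<rho>\<^sub>0 + \<rho>\<^sub>1 * (q - q\<^sub>0))\<bar> \<le> L * (q - q\<^sub>0)\<^sup>2) \<Longrightarrow>
      set_integrable lebesgue S (\<lambda>q. w q * exp (- J q)) \<and>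
      \<bar>(LINT q:S|lebesgue. w q * exp (- J q)) - \<rho>\<^sub>0 * s * saddle_const p\<bar> \<le> C0 * s ^ 3"
    proof (rule laplace_local[OF p, where \<psi> = "\<lambda>t. exp (- t)" and \<psi>' = "\<lambda>t. - exp (- t)" and
            \<psi>'' = "\<lambda>t. exp (- t)" and b=b and K="K / a" and L=L and \<rho>\<^sub>0=\<rho>\<^sub>0 and \<rho>\<^sub>1=\<rho>\<^sub>1 and
            q\<^sub>0=q\<^sub>0 and r=r, OF _ _ _ _ _ nn rB, folded S_def saddle_const_def])
      show "((\<lambda>t. exp (- t)) has_real_derivative - exp (- t)) (at t)" for t :: real
        by (auto intro!: derivative_eq_intros)
      show "((\<lambda>t. - exp (- t)) has_real_derivative exp (- t)) (at t)" for t :: real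
        by (auto intro!: derivative_eq_intros)
      fix t :: real assume t: "t \<ge> 0"
      have "1 \<le> 2 * exp (t / 2)" using half[of t] t by linarith
      from ge[OF this]
      show "\<bar>exp (- t)\<bar> \<le> 2 * exp (- t / 2)" "\<bar>- exp (- t)\<bar> \<le> 2 * exp (- t / 2)"
        "\<bar>exp (- t)\<bar> \<le> 2 * exp (- t / 2)"
        by simp_all
    qed blast
    \<comment> \<open>First moment: the excess action weighted by the Boltzmann factor.\<close>
    obtain C1 where C1: "\<And>s J w. s > 0 \<Longrightarrow>
      set_borel_measurable lebesgue S J \<Longrightarrow> set_borel_measurable lebesgue S w \<Longrightarrow>
      (\<And>q x. q \<in> S \<Longrightarrow> x = (q - q\<^sub>0) / s \<Longrightarrow>
        \<bar>J q - (x ^ p + s * b * x ^ (p + 1))\<bar> \<le> K / a * s\<^sup>2 * x ^ (p + 2)) \<Longrightarrow>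
      (\<And>q. q \<in> S \<Longrightarrow> \<bar>w q - (\<rho>\<^sub>0 + \<rho>\<^sub>1 * (q - q\<^sub>0))\<bar> \<le> L * (q - q\<^sub>0)\<^sup>2) \<Longrightarrow>
      set_integrable lebesgue S (\<lambda>q. w q * (J q * exp (- J q))) \<and>
      \<bar>(LINT q:S|lebesgue. w q * (J q * exp (- J q))) - \<rho>\<^sub>0 * s * (saddle_const p / p)\<bar> \<le> C1 * s ^ 3"
    proof (rule laplace_local[OF p, where \<psi> = "\<lambda>t. t * exp (- t)" and \<psi>' = "\<lambda>t. (1 - t) * exp (- t)" and
            \<psi>'' = "\<lambda>t. (t - 2) * exp (- t)" and b=b and K="K / a" and L=L and \<rho>\<^sub>0=\<rho>\<^sub>0 and \<rho>\<^sub>1=\<rho>\<^sub>1 and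
            q\<^sub>0=q\<^sub>0 and r=r, OF _ _ _ _ _ nn rB, folded S_def, unfolded first_moment_eq_saddle_const[OF p]])
      show "((\<lambda>t. t * exp (- t)) has_real_derivative (1 - t) * exp (- t)) (at t)" for t :: real
        by (auto intro!: derivative_eq_intros simp: algebra_simps)
      show "((\<lambda>t. (1 - t) * exp (- t)) has_real_derivative (t - 2) * exp (- t)) (at t)" for t :: real
        by (auto intro!: derivative_eq_intros simp: algebra_simps)
      fix t :: real assume t: "t \<ge> 0"
      have "\<bar>t\<bar> \<le> 2 * exp (t / 2)" "\<bar>1 - t\<bar> \<le> 2 * exp (t / 2)" "\<bar>t - 2\<bar> \<le> 2 * exp (t / 2)"
        using half[of t] t by linarith+
      from this[THEN ge]
      show "\<bar>t * exp (- t)\<bar> \<le> 2 * exp (- t / 2)" "\<bar>(1 - t) * exp (- t)\<bar> \<le> 2 * exp (- t / 2)"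
        "\<bar>(t - 2) * exp (- t)\<bar> \<le> 2 * exp (- t / 2)"
        by (simp_all add: abs_mult)
    qed blast
    have "\<forall>\<^sub>F g in at_right 0.
      set_integrable lebesgue S (\<lambda>q. \<rho> g q * exp (- (I g q - I g q\<^sub>0))) \<and>
      set_integrable lebesgue S (\<lambda>q. \<rho> g q * ((I g q - I g q\<^sub>0) * exp (- (I g q - I g q\<^sub>0)))) \<and>
      \<bar>(LINT q:S|lebesgue. \<rho> g q * exp (- (I g q - I g q\<^sub>0)))
        - \<rho>\<^sub>0 * (g / a) powr (1 / p) * saddle_const p\<bar> \<le> max C0 C1 * ((g / a) powr (1 / p)) ^ 3 \<and>
      \<bar>(LINT q:S|lebesgue. \<rho> g q * ((I g q - I g q\<^sub>0) * exp (- (I g q - I g q\<^sub>0))))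
        - \<rho>\<^sub>0 * (g / a) powr (1 / p) * (saddle_const p / p)\<bar> \<le> max C0 C1 * ((g / a) powr (1 / p)) ^ 3"
      using EK EL \<rho>m Im eventually_at_right_less[of 0]
    proof eventually_elim
      case (elim g)
      define s where "s = (g / a) powr (1 / p)"
      have s: "s > 0" using elim a by (simp add: s_def)
      have "s ^ p = (g / a) powr (1 / p * p)"
        using elim a s by (simp add: s_def powr_realpow[symmetric] powr_powr)
      then have sp: "g = a * s ^ p" using elim a p by simp
      have m\<rho>: "set_borel_measurable lebesgue S (\<rho> g)" and "set_borel_measurable lebesgue S (I g)"
        using elim SD S_sets by (auto intro: set_borel_measurable_subset)
      then have "(\<lambda>q. indicator S q *\<^sub>R I g q - indicator S q * I g q\<^sub>0) \<in> borel_measurable lebesgue"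
        using S_sets unfolding set_borel_measurable_def
        by (intro borel_measurable_diff borel_measurable_times borel_measurable_indicator
            borel_measurable_const)
      then have mJ: "set_borel_measurable lebesgue S (\<lambda>q. I g q - I g q\<^sub>0)"
        unfolding set_borel_measurable_def by (simp add: algebra_simps)
      have J: "\<bar>I g q - I g q\<^sub>0 - (x ^ p + s * b * x ^ (p + 1))\<bar> \<le> K / a * s\<^sup>2 * x ^ (p + 2)"
        if "q \<in> S" "x = (q - q\<^sub>0) / s" for q x
      proof -
        have sx: "q = q\<^sub>0 + s * x" "\<bar>s * x\<bar> < d1" using that s r by (auto simp: S_def)
        have 1: "1 / g * (a * (s * x) ^ p + a' * (s * x) ^ (p + 1)) = x ^ p + s * b * x ^ (p + 1)"
          unfolding sp using s a by (simp add: b_def power_mult_distrib field_simps)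
        have "1 / g * (s * x) ^ (p + 2) \<ge> 0"
          using elim p by (intro mult_nonneg_nonneg zero_le_even_power) auto
        then have "K * \<bar>1 / g * (s * x) ^ (p + 2)\<bar> = K * (1 / g * (s * x) ^ (p + 2))"
          by (simp only: abs_of_nonneg)
        also have "\<dots> = K / a * s\<^sup>2 * x ^ (p + 2)"
          unfolding sp using s a by (simp add: power_mult_distrib field_simps power2_eq_square)
        finally have 2: "K * \<bar>1 / g * (s * x) ^ (p + 2)\<bar> = K / a * s\<^sup>2 * x ^ (p + 2)" .
        show ?thesis
          using elim(1)[rule_format, OF sx(2), unfolded 1 2] by (simp only: sx(1) diff_diff_eq)
      qed
      have w: "\<bar>\<rho> g q - (\<rho>\<^sub>0 + \<rho>\<^sub>1 * (q - q\<^sub>0))\<bar> \<le> L * (q - q\<^sub>0)\<^sup>2" if "q \<in> S" for q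
        using elim(2)[rule_format, of "q - q\<^sub>0"] that r by (auto simp: S_def)
      have "C0 * s ^ 3 \<le> max C0 C1 * s ^ 3" "C1 * s ^ 3 \<le> max C0 C1 * s ^ 3"
        using s by (auto intro!: mult_right_mono)
      then show ?case
        using C0[OF s mJ m\<rho> J w] C1[OF s mJ m\<rho> J w] unfolding s_def[symmetric] by auto
    qed
    with SD show "{q\<^sub>0 - r<..<q\<^sub>0 + r} \<subseteq> D \<and> (\<exists>C. \<forall>\<^sub>F g in at_right 0.
      set_integrable lebesgue {q\<^sub>0 - r<..<q\<^sub>0 + r} (\<lambda>q. \<rho> g q * exp (- (I g q - I g q\<^sub>0))) \<and>
      set_integrable lebesgue {q\<^sub>0 - r<..<q\<^sub>0 + r} (\<lambda>q. \<rho> g q * ((I g q - I g q\<^sub>0) * exp (- (I g q - I g q\<^sub>0)))) \<and>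
      \<bar>(LINT q:{q\<^sub>0 - r<..<q\<^sub>0 + r}|lebesgue. \<rho> g q * exp (- (I g q - I g q\<^sub>0)))
        - \<rho>\<^sub>0 * (g / a) powr (1 / p) * saddle_const p\<bar> \<le> C * ((g / a) powr (1 / p)) ^ 3 \<and>
      \<bar>(LINT q:{q\<^sub>0 - r<..<q\<^sub>0 + r}|lebesgue. \<rho> g q * ((I g q - I g q\<^sub>0) * exp (- (I g q - I g q\<^sub>0))))
        - \<rho>\<^sub>0 * (g / a) powr (1 / p) * (saddle_const p / p)\<bar> \<le> C * ((g / a) powr (1 / p)) ^ 3)"
      unfolding S_def by blast
  qed
qed

section \<open>Quotients of moments and exponentially small tails\<close>

text \<open>The combination \<open>a1 - a0 / k\<close> cancels the leading terms and is at most
  \<open>2 * C * s ^ 3\<close>, where \<open>k \<ge> 1\<close> keeps the error of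
  \<open>a0 / k\<close> within \<open>C * s ^ 3\<close>. Dividing by
  \<open>a0 \<ge> s * m / 2\<close> costs one power of \<open>s\<close>.\<close>

lemma ratio_estimate:
  fixes a0 a1 m C s k :: real
  assumes "s > 0" "m > 0" "k \<ge> 1" "C \<ge> 0" and small: "C * s\<^sup>2 \<le> m / 2"
    and a0: "\<bar>a0 - s * m\<bar> \<le> C * s ^ 3" and a1: "\<bar>a1 - s * (m / k)\<bar> \<le> C * s ^ 3"
  shows "a0 > 0" and "\<bar>a1 / a0 - 1 / k\<bar> \<le> 4 * C / m * s\<^sup>2"
proof -
  have "C * s ^ 3 = s * (C * s\<^sup>2)" by (simp add: power2_eq_square power3_eq_cube)
  also have "\<dots> \<le> s * (m / 2)" using assms by (intro mult_left_mono) auto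
  finally have lo: "a0 \<ge> s * (m / 2)" using a0 by (simp add: abs_le_iff)
  moreover have pos: "s * (m / 2) > 0" using assms by simp
  ultimately show a0_pos: "a0 > 0" by linarith
  have "\<bar>(a0 - s * m) / k\<bar> = \<bar>a0 - s * m\<bar> / k" using assms by simp
  also have "\<dots> \<le> \<bar>a0 - s * m\<bar> / 1" using assms by (intro divide_left_mono) auto
  finally have "\<bar>(a0 - s * m) / k\<bar> \<le> C * s ^ 3" using a0 by simp
  then have "\<bar>(a1 - s * (m / k)) - (a0 - s * m) / k\<bar> \<le> C * s ^ 3 + C * s ^ 3"
    by (intro order_trans[OF abs_triangle_ineq4] add_mono a1)
  also have "(a1 - s * (m / k)) - (a0 - s * m) / k = a1 - a0 / k" by (simp add: diff_divide_distrib)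
  finally have num: "\<bar>a1 - a0 / k\<bar> \<le> 2 * C * s ^ 3" by simp
  have "a1 / a0 - 1 / k = (a1 - a0 / k) / a0" using a0_pos by (simp add: diff_divide_distrib)
  then have "\<bar>a1 / a0 - 1 / k\<bar> = \<bar>a1 - a0 / k\<bar> / a0" using a0_pos by simp
  also have "\<dots> \<le> (2 * C * s ^ 3) / (s * (m / 2))"
    using num lo pos assms by (intro frac_le) auto
  also have "\<dots> = 4 * C / m * s\<^sup>2" using assms by (simp add: power2_eq_square power3_eq_cube)
  finally show "\<bar>a1 / a0 - 1 / k\<bar> \<le> 4 * C / m * s\<^sup>2" .
qed

text \<open>The quadratic Taylor bound for \<open>exp (c / g)\<close> gives decay
  \<open>g\<^sup>2\<close>, and \<open>g \<le> 1\<close> allows any smaller exponent. It is applied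
  with exponent \<open>3 / p\<close>, at most \<open>3 / 2\<close>, to match
  \<open>s ^ 3\<close>.\<close>

lemma exp_neg_inverse_le_powr:
  fixes c g \<alpha> :: real
  assumes "c > 0" "0 < g" "g \<le> 1" "\<alpha> \<le> 2"
  shows "exp (- c / g) \<le> 2 / c\<^sup>2 * g powr \<alpha>"
proof -
  have "c / g \<ge> 0" using assms by simp
  with exp_lower_Taylor_quadratic[OF this] have "(c / g)\<^sup>2 / 2 \<le> exp (c / g)" by linarith
  then have "exp (- (c / g)) \<le> 1 / ((c / g)\<^sup>2 / 2)"
    using assms unfolding exp_minus inverse_eq_divide by (intro divide_left_mono) auto
  also have "\<dots> = 2 / c\<^sup>2 * g powr 2" using assms by (simp add: power_divide)
  also have "\<dots> \<le> 2 / c\<^sup>2 * g powr \<alpha>" using assms by (intro mult_left_mono powr_mono') auto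
  finally show ?thesis by simp
qed

section \<open>Local partition function and mean free energy\<close>

theorem proposition1:
  fixes p :: nat and D :: "real set" and q\<^sub>0 a\<^sub>p a\<^sub>p\<^sub>1 \<rho>\<^sub>0 \<rho>\<^sub>1 :: real
    and \<beta> T\<^sub>E \<N> :: "real \<Rightarrow> real"
    and F\<^sub>g\<^sub>e\<^sub>n I\<^sub>E \<rho> :: "real \<Rightarrow> real \<Rightarrow> real"
  assumes "p \<ge> 2" and "even p"
    and "is_interval D" and "q\<^sub>0 \<in> interior D"
    and "\<forall>\<^sub>F g in at_right 0. \<beta> g > 0 \<and> T\<^sub>E g = inverse (\<beta> g)"
    and "\<forall>\<^sub>F g in at_right 0. \<N> g > 0"
    and "\<forall>\<^sub>F g in at_right 0. \<forall>q\<in>D. \<rho> g q \<ge> 0"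
    and "\<forall>\<^sub>F g in at_right 0. \<forall>q\<in>D. I\<^sub>E g q = \<beta> g * F\<^sub>g\<^sub>e\<^sub>n g q"
    and "\<forall>\<^sub>F g in at_right 0. set_borel_measurable lebesgue D (\<rho> g)"
    and "\<forall>\<^sub>F g in at_right 0. set_borel_measurable lebesgue D (I\<^sub>E g)"
    and "unique_dominant_minimum D q\<^sub>0 \<rho> I\<^sub>E"
    and "(\<lambda>(g, \<delta>). I\<^sub>E g (q\<^sub>0 + \<delta>) - (I\<^sub>E g q\<^sub>0 + 1 / g * (a\<^sub>p * \<delta> ^ p + a\<^sub>p\<^sub>1 * \<delta> ^ (p + 1))))
           \<in> O[at_right 0 \<times>\<^sub>F nhds 0](\<lambda>(g, \<delta>). 1 / g * \<delta> ^ (p + 2))"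
    and "(\<lambda>(g, \<delta>). \<rho> g (q\<^sub>0 + \<delta>) - (\<rho>\<^sub>0 + \<rho>\<^sub>1 * \<delta>)) \<in> O[at_right 0 \<times>\<^sub>F nhds 0](\<lambda>(g, \<delta>). \<delta> ^ 2)"
    and "a\<^sub>p > 0" and "\<rho>\<^sub>0 > 0"
  shows "(\<lambda>g. mean_free_energy D (\<N> g) (\<rho> g) (F\<^sub>g\<^sub>e\<^sub>n g) (I\<^sub>E g) - I\<^sub>E g q\<^sub>0 / \<beta> g - T\<^sub>E g / real p)
           \<in> O[at_right 0](\<lambda>g. T\<^sub>E g * g powr (2 / real p))
       \<and> (\<forall>\<^sub>F r in at_right 0. \<exists>\<epsilon> \<in> O[at_right 0](\<lambda>g. g powr (2 / real p)).
            \<forall>\<^sub>F g in at_right 0.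
              partition_function {q. \<bar>q - q\<^sub>0\<bar> < r} (\<N> g) (\<rho> g) (I\<^sub>E g) =
                exp (- I\<^sub>E g q\<^sub>0) * \<N> g * \<rho>\<^sub>0 * saddle_const p * (g / a\<^sub>p) powr (1 / real p)
                  * (1 + \<epsilon> g))
       \<and> saddle_const p = 2 / real p * Gamma (1 / real p)"
proof (intro conjI)
  let ?s = "\<lambda>g. (g / a\<^sub>p) powr (1 / real p)"
  let ?S = "\<lambda>r. {q\<^sub>0 - r<..<q\<^sub>0 + r}"
  let ?J = "\<lambda>g q. I\<^sub>E g q - I\<^sub>E g q\<^sub>0"
  define M where "M = saddle_const p"
  have p: "even p" "p > 0" using assms(1,2) by auto
  have M: "M > 0" using saddle_const_pos[OF p] by (simp add: M_def)
  show "saddle_const p = 2 / real p * Gamma (1 / real p)" by (rule saddle_const_eq[OF p])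
  note loc = saddle_local[OF p assms(4,9,10,12,13,14,15), folded M_def]
  have s2: "(?s g)\<^sup>2 = g powr (2 / real p) / a\<^sub>p powr (2 / real p)" if "g > 0" for g
  proof -
    have "(?s g)\<^sup>2 = ?s g powr 2" using that assms(14) by (simp add: powr_numeral)
    then show ?thesis using that assms(14) by (simp add: powr_powr powr_divide)
  qed
  have s3: "?s g ^ 3 = g powr (3 / real p) / a\<^sub>p powr (3 / real p)" if "g > 0" for g
  proof -
    have "?s g ^ 3 = ?s g powr 3" using that assms(14) by (simp add: powr_numeral)
    then show ?thesis using that assms(14) by (simp add: powr_powr powr_divide)
  qed

  show "\<forall>\<^sub>F r in at_right 0. \<exists>\<epsilon> \<in> O[at_right 0](\<lambda>g. g powr (2 / real p)).
      \<forall>\<^sub>F g in at_right 0.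
        partition_function {q. \<bar>q - q\<^sub>0\<bar> < r} (\<N> g) (\<rho> g) (I\<^sub>E g) =
          exp (- I\<^sub>E g q\<^sub>0) * \<N> g * \<rho>\<^sub>0 * saddle_const p * ?s g * (1 + \<epsilon> g)"
    using loc
  proof eventually_elim
    case (elim r)
    define A where "A = (\<lambda>g. LINT q:?S r|lebesgue. \<rho> g q * exp (- ?J g q))"
    \<comment> \<open>The relative error of the local integral: an absolute error of order
      \<open>s ^ 3\<close> over a leading term of order \<open>s\<close>, hence of order
      \<open>s\<^sup>2\<close>, that is \<open>g powr (2 / p)\<close>.\<close>
    define \<epsilon> where "\<epsilon> = (\<lambda>g. A g / (\<rho>\<^sub>0 * ?s g * M) - 1)"
    from elim have "\<exists>C. \<forall>\<^sub>F g in at_right 0. \<bar>A g - \<rho>\<^sub>0 * ?s g * M\<bar> \<le> C * ?s g ^ 3"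
      unfolding A_def by (elim conjE exE) (rule exI, erule eventually_mono, blast)
    then obtain C where "\<forall>\<^sub>F g in at_right 0. \<bar>A g - \<rho>\<^sub>0 * ?s g * M\<bar> \<le> C * ?s g ^ 3" by blast
    then have "\<forall>\<^sub>F g in at_right 0. norm (\<epsilon> g)
        \<le> C / (\<rho>\<^sub>0 * M * a\<^sub>p powr (2 / real p)) * norm (g powr (2 / real p))"
      using eventually_at_right_less[of 0]
    proof eventually_elim
      case (elim g)
      have s: "?s g > 0" using elim assms(14) by simp
      have "\<epsilon> g = (A g - \<rho>\<^sub>0 * ?s g * M) / (\<rho>\<^sub>0 * ?s g * M)"
        using s M assms(15) by (simp add: \<epsilon>_def diff_divide_distrib)
      then have "norm (\<epsilon> g) = \<bar>A g - \<rho>\<^sub>0 * ?s g * M\<bar> / (\<rho>\<^sub>0 * ?s g * M)"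
        using s M assms(15) by (simp add: abs_mult)
      also have "\<dots> \<le> C * ?s g ^ 3 / (\<rho>\<^sub>0 * ?s g * M)"
        using elim s M assms(15) by (intro divide_right_mono) auto
      also have "\<dots> = C / (\<rho>\<^sub>0 * M) * (?s g)\<^sup>2"
        using s by (simp add: power2_eq_square power3_eq_cube)
      finally show ?case using elim s2[of g] by simp
    qed
    then have "\<epsilon> \<in> O[at_right 0](\<lambda>g. g powr (2 / real p))" by (rule bigoI)
    moreover have "\<forall>\<^sub>F g in at_right 0.
        partition_function {q. \<bar>q - q\<^sub>0\<bar> < r} (\<N> g) (\<rho> g) (I\<^sub>E g) =
          exp (- I\<^sub>E g q\<^sub>0) * \<N> g * \<rho>\<^sub>0 * saddle_const p * ?s g * (1 + \<epsilon> g)"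
      using eventually_at_right_less[of 0]
    proof eventually_elim
      case (elim g)
      have s: "?s g > 0" using elim assms(14) by simp
      have S: "{q. \<bar>q - q\<^sub>0\<bar> < r} = ?S r" by auto
      have "\<N> g * \<rho> g q * exp (- I\<^sub>E g q) = (\<N> g * exp (- I\<^sub>E g q\<^sub>0)) * (\<rho> g q * exp (- ?J g q))" for q
        by (simp add: exp_diff exp_minus field_simps)
      then have "partition_function {q. \<bar>q - q\<^sub>0\<bar> < r} (\<N> g) (\<rho> g) (I\<^sub>E g) = (\<N> g * exp (- I\<^sub>E g q\<^sub>0)) * A g"
        unfolding partition_function_def S A_def by (simp only: set_integral_mult_right)
      also have "A g = \<rho>\<^sub>0 * ?s g * M * (1 + \<epsilon> g)"
        using s M assms(15) by (simp add: \<epsilon>_def)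
      finally show ?case by (simp add: M_def)
    qed
    ultimately show ?case by blast
  qed

  \<comment> \<open>A single radius that serves both the local estimates and the tail bound. It
    exists because both properties hold for all sufficiently small \<open>r > 0\<close>.\<close>
  obtain r where r: "?S r \<subseteq> D"
    and loc_r: "\<exists>C. \<forall>\<^sub>F g in at_right 0.
      set_integrable lebesgue (?S r) (\<lambda>q. \<rho> g q * exp (- ?J g q)) \<and>
      set_integrable lebesgue (?S r) (\<lambda>q. \<rho> g q * (?J g q * exp (- ?J g q))) \<and>
      \<bar>(LINT q:?S r|lebesgue. \<rho> g q * exp (- ?J g q)) - \<rho>\<^sub>0 * ?s g * M\<bar> \<le> C * ?s g ^ 3 \<and>
      \<bar>(LINT q:?S r|lebesgue. \<rho> g q * (?J g q * exp (- ?J g q))) - \<rho>\<^sub>0 * ?s g * (M / p)\<bar> \<le> C * ?s g ^ 3"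
    and udm_r: "\<exists>c>0.
        (\<forall>\<^sub>F g in at_right 0. set_integrable lebesgue (D - ?S r)
           (\<lambda>q. \<rho> g q * (1 + \<bar>?J g q\<bar>) * exp (- ?J g q))) \<and>
        (\<lambda>g. LINT q:D - ?S r|lebesgue. \<rho> g q * (1 + \<bar>?J g q\<bar>) * exp (- ?J g q))
          \<in> O[at_right 0](\<lambda>g. exp (- c / g))"
    using eventually_happens[OF eventually_conj[OF loc assms(11)[unfolded unique_dominant_minimum_def]]]
    by (auto simp: trivial_limit_at_right_real)
  from loc_r obtain C where C: "\<forall>\<^sub>F g in at_right 0.
      set_integrable lebesgue (?S r) (\<lambda>q. \<rho> g q * exp (- ?J g q)) \<and>
      set_integrable lebesgue (?S r) (\<lambda>q. \<rho> g q * (?J g q * exp (- ?J g q))) \<and>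
      \<bar>(LINT q:?S r|lebesgue. \<rho> g q * exp (- ?J g q)) - \<rho>\<^sub>0 * ?s g * M\<bar> \<le> C * ?s g ^ 3 \<and>
      \<bar>(LINT q:?S r|lebesgue. \<rho> g q * (?J g q * exp (- ?J g q))) - \<rho>\<^sub>0 * ?s g * (M / p)\<bar> \<le> C * ?s g ^ 3"
    by blast
  define R where "R = D - ?S r"
  from udm_r obtain c where c: "c > 0"
    and Ri: "\<forall>\<^sub>F g in at_right 0. set_integrable lebesgue R (\<lambda>q. \<rho> g q * (1 + \<bar>?J g q\<bar>) * exp (- ?J g q))"
    and RO: "(\<lambda>g. LINT q:R|lebesgue. \<rho> g q * (1 + \<bar>?J g q\<bar>) * exp (- ?J g q))
          \<in> O[at_right 0](\<lambda>g. exp (- c / g))"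
    unfolding R_def by blast
  from RO obtain C' where C': "C' > 0" and
    Rb: "\<forall>\<^sub>F g in at_right 0. norm (LINT q:R|lebesgue. \<rho> g q * (1 + \<bar>?J g q\<bar>) * exp (- ?J g q))
          \<le> C' * norm (exp (- c / g))"
    by (rule landau_o.bigE)
  \<comment> \<open>One constant for saddle and tail together. The second summand is the tail bound
    \<open>C' * exp (- c / g)\<close> rewritten as a multiple of \<open>s ^ 3\<close>;
    \<open>\<bar>C\<bar>\<close> is taken as the sign of \<open>C\<close> is unknown.\<close>
  define C2 where "C2 = \<bar>C\<bar> + C' * (2 / c\<^sup>2 * a\<^sub>p powr (3 / real p))"
  have C2: "C2 \<ge> 0" using C' by (simp add: C2_def)
  have D_sets: "D \<in> sets lebesgue"
    using real_interval_borel_measurable[OF assms(3)] by simp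
  have R_sets: "R \<in> sets lebesgue" and SR: "D = ?S r \<union> R" "?S r \<inter> R = {}"
    using D_sets r by (auto simp: R_def)
  \<comment> \<open>Since \<open>s\<close> tends to 0, the smallness condition of
    \<open>ratio_estimate\<close> eventually holds, which also makes the full integral
    \<open>Z0\<close> positive.\<close>
  have "((\<lambda>g. C2 * (?s g)\<^sup>2) \<longlongrightarrow> C2 * (0 / a\<^sub>p powr (2 / real p))) (at_right 0)"
  proof (rule Lim_transform_eventually)
    have "((\<lambda>g. g powr (2 / real p)) \<longlongrightarrow> 0) (at_right (0::real))"
      using p by (intro tendsto_zero_powrI[where b = "2 / real p"] tendsto_const tendsto_ident_at
          eventually_mono[OF eventually_at_right_less less_imp_le]) auto
    then show "((\<lambda>g. C2 * (g powr (2 / real p) / a\<^sub>p powr (2 / real p)))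
        \<longlongrightarrow> C2 * (0 / a\<^sub>p powr (2 / real p))) (at_right 0)"
      using assms(14) by (intro tendsto_intros) auto
    show "\<forall>\<^sub>F g in at_right 0. C2 * (g powr (2 / real p) / a\<^sub>p powr (2 / real p)) = C2 * (?s g)\<^sup>2"
      using eventually_at_right_less[of 0] by eventually_elim (simp add: s2)
  qed
  then have "\<forall>\<^sub>F g in at_right 0. C2 * (?s g)\<^sup>2 < \<rho>\<^sub>0 * M / 2"
    by (rule order_tendstoD(2)) (use M assms(15) in simp)
  then have small: "\<forall>\<^sub>F g in at_right 0. C2 * (?s g)\<^sup>2 \<le> \<rho>\<^sub>0 * M / 2"
    by eventually_elim simp
  have "\<forall>\<^sub>F g in at_right 0. g < (1::real)"
    unfolding eventually_at_right_field by (intro exI[of _ 1]) auto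
  with C Ri Rb small assms(5-10) eventually_at_right_less[of 0]
  have "\<forall>\<^sub>F g in at_right 0.
    norm (mean_free_energy D (\<N> g) (\<rho> g) (F\<^sub>g\<^sub>e\<^sub>n g) (I\<^sub>E g) - I\<^sub>E g q\<^sub>0 / \<beta> g - T\<^sub>E g / real p)
      \<le> 4 * C2 / (\<rho>\<^sub>0 * M) / a\<^sub>p powr (2 / real p) * norm (T\<^sub>E g * g powr (2 / real p))"
  proof eventually_elim
    case (elim g)
    let ?w0 = "\<lambda>q. \<rho> g q * exp (- ?J g q)" and ?w1 = "\<lambda>q. \<rho> g q * (?J g q * exp (- ?J g q))"
    let ?W = "\<lambda>q. \<rho> g q * (1 + \<bar>?J g q\<bar>) * exp (- ?J g q)"
    have g: "g > 0" "g \<le> 1" using elim by auto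
    have s: "?s g > 0" using g assms(14) by simp
    have \<beta>: "\<beta> g > 0" and T: "T\<^sub>E g = 1 / \<beta> g" and N: "\<N> g > 0"
      using elim by (auto simp: inverse_eq_divide)
    have \<rho>: "\<rho> g q \<ge> 0" and F: "I\<^sub>E g q = \<beta> g * F\<^sub>g\<^sub>e\<^sub>n g q" if "q \<in> D" for q using elim that by auto
    have W: "set_integrable lebesgue R ?W" using elim by blast
    have RD: "R \<subseteq> D" by (auto simp: R_def)
    have m: "set_borel_measurable lebesgue R (\<rho> g)" "set_borel_measurable lebesgue R (I\<^sub>E g)"
      using elim RD R_sets by (auto intro: set_borel_measurable_subset)
    \<comment> \<open>Measurability is known on \<open>R\<close> only, so the action is cut off
      inside the exponential; the cut-off density annihilates the altered values.\<close>
    have eq0: "(\<lambda>q. indicator R q *\<^sub>R ?w0 q)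
        = (\<lambda>q. (indicator R q *\<^sub>R \<rho> g q) * exp (- (indicator R q *\<^sub>R I\<^sub>E g q - I\<^sub>E g q\<^sub>0)))"
      and eq1: "(\<lambda>q. indicator R q *\<^sub>R ?w1 q)
        = (\<lambda>q. (indicator R q *\<^sub>R \<rho> g q) * ((indicator R q *\<^sub>R I\<^sub>E g q - I\<^sub>E g q\<^sub>0) *
            exp (- (indicator R q *\<^sub>R I\<^sub>E g q - I\<^sub>E g q\<^sub>0))))"
      by (auto simp: fun_eq_iff indicator_def)
    have wm: "set_borel_measurable lebesgue R ?w0" "set_borel_measurable lebesgue R ?w1"
      using m unfolding set_borel_measurable_def eq0 eq1 by measurable
    \<comment> \<open>The factor \<open>1 + \<bar>J\<bar>\<close> in the suppression hypothesis
      dominates both weights, so the same tail bound controls the partition function and the first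
      moment.\<close>
    have le: "\<bar>?w0 q\<bar> \<le> ?W q \<and> \<bar>?w1 q\<bar> \<le> ?W q" if "q \<in> R" for q
    proof -
      have pos: "\<rho> g q \<ge> 0" using \<rho> that RD by auto
      have "\<rho> g q * 1 * exp (- ?J g q) \<le> ?W q" "\<rho> g q * \<bar>?J g q\<bar> * exp (- ?J g q) \<le> ?W q"
        using pos by (intro mult_right_mono mult_left_mono; simp)+
      then show ?thesis using pos by (simp add: abs_mult)
    qed
    note le0 = le[THEN conjunct1] and le1 = le[THEN conjunct2]
    have i0: "set_integrable lebesgue R ?w0"
      by (rule set_integrable_bound[OF W wm(1)], rule AE_I2, rule impI, unfold real_norm_def)
         (rule order_trans[OF le0 abs_ge_self])
    have i1: "set_integrable lebesgue R ?w1"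
      by (rule set_integrable_bound[OF W wm(2)], rule AE_I2, rule impI, unfold real_norm_def)
         (rule order_trans[OF le1 abs_ge_self])
    have bd: "\<bar>LINT q:R|lebesgue. f q\<bar> \<le> C' * (2 / c\<^sup>2 * a\<^sub>p powr (3 / real p)) * ?s g ^ 3"
      if "set_integrable lebesgue R f" "\<And>q. q \<in> R \<Longrightarrow> \<bar>f q\<bar> \<le> ?W q" for f
    proof -
      have "\<bar>LINT q:R|lebesgue. f q\<bar> \<le> (LINT q:R|lebesgue. \<bar>f q\<bar>)"
        using set_integral_norm_bound[OF that(1)] by simp
      also have "\<dots> \<le> (LINT q:R|lebesgue. ?W q)"
        by (rule set_integral_mono[OF set_integrable_abs[OF that(1)] W that(2)])
      also have "\<dots> \<le> C' * exp (- c / g)" using elim by simp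
      also have "\<dots> \<le> C' * (2 / c\<^sup>2 * g powr (3 / real p))"
        using C' c g assms(1) by (intro mult_left_mono exp_neg_inverse_le_powr) (auto simp: divide_le_eq)
      also have "\<dots> = C' * (2 / c\<^sup>2 * a\<^sub>p powr (3 / real p)) * ?s g ^ 3"
        using s3[OF g(1)] assms(14) by simp
      finally show ?thesis .
    qed
    \<comment> \<open>The zeroth and first moments of the excess action over all of
      \<open>D\<close>, with \<open>\<N> g\<close> and \<open>exp (- I\<^sub>E g q\<^sub>0)\<close>
      taken out.\<close>
    define Z0 where "Z0 = (LINT q:D|lebesgue. ?w0 q)"
    define Z1 where "Z1 = (LINT q:D|lebesgue. ?w1 q)"
    have iS: "set_integrable lebesgue (?S r) ?w0" "set_integrable lebesgue (?S r) ?w1"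
      using elim by auto
    have Z0: "Z0 = (LINT q:?S r|lebesgue. ?w0 q) + (LINT q:R|lebesgue. ?w0 q)"
      unfolding Z0_def SR(1) by (rule set_integral_Un[OF SR(2) iS(1) i0])
    have Z1: "Z1 = (LINT q:?S r|lebesgue. ?w1 q) + (LINT q:R|lebesgue. ?w1 q)"
      unfolding Z1_def SR(1) by (rule set_integral_Un[OF SR(2) iS(2) i1])
    have D0: "set_integrable lebesgue D ?w0" and D1: "set_integrable lebesgue D ?w1"
      unfolding SR(1) by (intro set_integrable_Un i0 i1 iS R_sets; simp)+
    have CC: "C * ?s g ^ 3 \<le> \<bar>C\<bar> * ?s g ^ 3" using s by (intro mult_right_mono) auto
    have Z0b: "\<bar>Z0 - ?s g * (\<rho>\<^sub>0 * M)\<bar> \<le> C2 * ?s g ^ 3"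
    proof -
      have "\<bar>(LINT q:?S r|lebesgue. ?w0 q) - ?s g * (\<rho>\<^sub>0 * M)\<bar> \<le> C * ?s g ^ 3"
        using elim by (simp add: mult_ac)
      then show ?thesis using bd[OF i0 le0] CC unfolding Z0 C2_def distrib_right by linarith
    qed
    have Z1b: "\<bar>Z1 - ?s g * (\<rho>\<^sub>0 * M / p)\<bar> \<le> C2 * ?s g ^ 3"
    proof -
      have "\<bar>(LINT q:?S r|lebesgue. ?w1 q) - ?s g * (\<rho>\<^sub>0 * M / p)\<bar> \<le> C * ?s g ^ 3"
        using elim by (simp add: mult_ac)
      then show ?thesis using bd[OF i1 le1] CC unfolding Z1 C2_def distrib_right by linarith
    qed
    have "\<rho>\<^sub>0 * M > 0" "real p \<ge> 1" "C2 * (?s g)\<^sup>2 \<le> \<rho>\<^sub>0 * M / 2"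
      using M assms(1,15) elim by auto
    note ratio_estimate[OF s this(1,2) C2 this(3) Z0b Z1b]
    then have Z0p: "Z0 > 0" and ratio: "\<bar>Z1 / Z0 - 1 / p\<bar> \<le> 4 * C2 / (\<rho>\<^sub>0 * M) * (?s g)\<^sup>2"
      by auto
    have e: "exp (- I\<^sub>E g q) = exp (- I\<^sub>E g q\<^sub>0) * exp (- ?J g q)" for q
      by (simp flip: exp_add)
    have Z: "partition_function D (\<N> g) (\<rho> g) (I\<^sub>E g) = (\<N> g * exp (- I\<^sub>E g q\<^sub>0)) * Z0"
    proof -
      have "\<N> g * \<rho> g q * exp (- I\<^sub>E g q) = (\<N> g * exp (- I\<^sub>E g q\<^sub>0)) * ?w0 q" for q
        by (simp only: e[of q] mult_ac)
      then show ?thesis unfolding partition_function_def Z0_def by (simp only: set_integral_mult_right)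
    qed
    \<comment> \<open>On \<open>D\<close> the free energy is
      \<open>(I\<^sub>E g q\<^sub>0 + J) / \<beta> g\<close>, which splits the numerator into the
      classical part and the first moment.\<close>
    have "(LINT q:D|lebesgue. \<N> g * \<rho> g q * F\<^sub>g\<^sub>e\<^sub>n g q * exp (- I\<^sub>E g q))
      = (LINT q:D|lebesgue. (\<N> g * exp (- I\<^sub>E g q\<^sub>0) / \<beta> g) * (I\<^sub>E g q\<^sub>0 * ?w0 q + ?w1 q))"
    proof (rule set_lebesgue_integral_cong[OF D_sets], intro allI impI)
      fix q assume q: "q \<in> D"
      have F_eq: "F\<^sub>g\<^sub>e\<^sub>n g q = (I\<^sub>E g q\<^sub>0 + ?J g q) / \<beta> g" using F[OF q] \<beta> by simp
      have "n * w * ((i + j) / b) * (x * y) = (n * x / b) * (i * (w * y) + w * (j * y))"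
        for n w i j b x y :: real by (simp add: algebra_simps add_divide_distrib)
      then show "\<N> g * \<rho> g q * F\<^sub>g\<^sub>e\<^sub>n g q * exp (- I\<^sub>E g q)
        = (\<N> g * exp (- I\<^sub>E g q\<^sub>0) / \<beta> g) * (I\<^sub>E g q\<^sub>0 * ?w0 q + ?w1 q)"
        unfolding e[of q] F_eq .
    qed
    also have "\<dots> = (\<N> g * exp (- I\<^sub>E g q\<^sub>0) / \<beta> g) * (I\<^sub>E g q\<^sub>0 * Z0 + Z1)"
      unfolding Z0_def Z1_def
      by (simp only: set_integral_mult_right set_integral_add(2)[OF set_integrable_mult_right[OF D0] D1])
    finally have num: "(LINT q:D|lebesgue. \<N> g * \<rho> g q * F\<^sub>g\<^sub>e\<^sub>n g q * exp (- I\<^sub>E g q))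
      = (\<N> g * exp (- I\<^sub>E g q\<^sub>0) / \<beta> g) * (I\<^sub>E g q\<^sub>0 * Z0 + Z1)" .
    \<comment> \<open>The common prefactor cancels and the classical term drops out exactly, leaving
      a quotient to which the ratio bound applies.\<close>
    have "mean_free_energy D (\<N> g) (\<rho> g) (F\<^sub>g\<^sub>e\<^sub>n g) (I\<^sub>E g) - I\<^sub>E g q\<^sub>0 / \<beta> g - T\<^sub>E g / real p
      = T\<^sub>E g * (Z1 / Z0 - 1 / p)"
      unfolding mean_free_energy_def num Z T using Z0p N \<beta> p by (simp add: field_simps)
    then have "norm (mean_free_energy D (\<N> g) (\<rho> g) (F\<^sub>g\<^sub>e\<^sub>n g) (I\<^sub>E g) - I\<^sub>E g q\<^sub>0 / \<beta> g - T\<^sub>E g / real p)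
      = T\<^sub>E g * \<bar>Z1 / Z0 - 1 / p\<bar>" using T \<beta> by (simp add: abs_mult)
    also have "\<dots> \<le> T\<^sub>E g * (4 * C2 / (\<rho>\<^sub>0 * M) * (?s g)\<^sup>2)"
      using ratio T \<beta> by (intro mult_left_mono) auto
    also have "\<dots> = 4 * C2 / (\<rho>\<^sub>0 * M) / a\<^sub>p powr (2 / real p) * norm (T\<^sub>E g * g powr (2 / real p))"
      using T \<beta> by (simp add: s2[OF g(1)] abs_mult)
    finally show ?case .
  qed
  then show "(\<lambda>g. mean_free_energy D (\<N> g) (\<rho> g) (F\<^sub>g\<^sub>e\<^sub>n g) (I\<^sub>E g) - I\<^sub>E g q\<^sub>0 / \<beta> g - T\<^sub>E g / real p)
      \<in> O[at_right 0](\<lambda>g. T\<^sub>E g * g powr (2 / real p))"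
    by (rule bigoI)
qed

end
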